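(* Let $H$ be a fixed balanced graph with $v_H\ge 4$ and minimum degree $\delta_H\ge 2$, and let $\lambda=(e_H-2)/(v_H-2)$. Then, as $n\to\infty$, $$p_c(n,H)=n^{-1/\lambda+o(1)}.$$
   Context: All graphs are finite and simple. $v_F$ and $e_F$ denote the numbers of vertices and edges of a graph $F$; $F\subset H$ means $F$ is a (not necessarily induced) subgraph of $H$. $H$-percolation: for graphs $G$ and $H$, set $G_0=G$ and, for $t\ge 1$, let $G_t$ (on the same vertex set as $G$) be obtained from $G_{t-1}$ by adding every edge not in $G_{t-1}$ which, if added to $G_{t-1}$, creates a new copy of $H$. Let $\langle G\rangle_H=\bigcup_t G_t$. $\mathcal G_{n,p}$ is the Erdős–Rényi random graph on $n$ labelled vertices, each edge of $K_n$ being present independently with probability $p$. The critical threshold is $$p_c(n,H)=\inf\{p>0:\ \mathbb P(\langle \mathcal G_{n,p}\rangle_H=K_n)\ge 1/2\}.$$ A graph $H$ is balanced if $v_H\ge 4$ and $(e_F-1)/(v_F-2)\le \lambda$ for all subgraphs $F\subset H$ with $3\le v_F<v_H$, where $\lambda=(e_H-2)/(v_H-2)$. *)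

theory Defs
  imports "HOL-Probability.Probability"
begin

text \<open>A graph is a pair of a vertex set and a set of two-element sets of vertices.\<close>

type_synonym 'a graph = "'a set \<times> 'a set set"

abbreviation verts :: "'a graph \<Rightarrow> 'a set" where
  "verts \<equiv> fst"

abbreviation edges :: "'a graph \<Rightarrow> 'a set set" where
  "edges \<equiv> snd"

definition pairs :: "'a set \<Rightarrow> 'a set set" where
  "pairs V = {e. e \<subseteq> V \<and> card e = 2}"

definition simple_graph :: "'a graph \<Rightarrow> bool" where
  "simple_graph G \<longleftrightarrow> finite (verts G) \<and> edges G \<subseteq> pairs (verts G)"

definition complete_graph :: "'a set \<Rightarrow> 'a graph" where
  "complete_graph V = (V, pairs V)"

definition subgraph :: "'a graph \<Rightarrow> 'a graph \<Rightarrow> bool" where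
  "subgraph F G \<longleftrightarrow> simple_graph F \<and> verts F \<subseteq> verts G \<and> edges F \<subseteq> edges G"

definition isomorphic :: "'a graph \<Rightarrow> 'b graph \<Rightarrow> bool" where
  "isomorphic H F \<longleftrightarrow> (\<exists>f. bij_betw f (verts H) (verts F) \<and> edges F = (\<lambda>e. f ` e) ` edges H)"

definition degree :: "'a graph \<Rightarrow> 'a \<Rightarrow> nat" where
  "degree G v = card {e \<in> edges G. v \<in> e}"

definition min_degree :: "'a graph \<Rightarrow> nat" where
  "min_degree G = Min (degree G ` verts G)"

definition lam :: "'a graph \<Rightarrow> real" where
  "lam H = (real (card (edges H)) - 2) / (real (card (verts H)) - 2)"

definition balanced :: "'a graph \<Rightarrow> bool" where
  "balanced H \<longleftrightarrow> card (verts H) \<ge> 4 \<and>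
     (\<forall>F. subgraph F H \<and> 3 \<le> card (verts F) \<and> card (verts F) < card (verts H) \<longrightarrow>
        (real (card (edges F)) - 1) / (real (card (verts F)) - 2) \<le> lam H)"

definition add_edge :: "'a set \<Rightarrow> 'a graph \<Rightarrow> 'a graph" where
  "add_edge e G = (verts G, insert e (edges G))"

text \<open>A copy of \<open>H\<close> in a graph is a subgraph isomorphic to \<open>H\<close>; it is new
  if it was not already a subgraph before the edge was added.\<close>

definition creates_copy :: "'a graph \<Rightarrow> 'b graph \<Rightarrow> 'b set \<Rightarrow> bool" where
  "creates_copy H G e \<longleftrightarrow>
     (\<exists>F. isomorphic H F \<and> subgraph F (add_edge e G) \<and> \<not> subgraph F G)"

definition perc_step :: "'a graph \<Rightarrow> 'b graph \<Rightarrow> 'b graph" where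
  "perc_step H G =
     (verts G, edges G \<union> {e \<in> pairs (verts G). e \<notin> edges G \<and> creates_copy H G e})"

definition perc_closure :: "'a graph \<Rightarrow> 'b graph \<Rightarrow> 'b graph" where
  "perc_closure H G = (verts G, \<Union>t. edges ((perc_step H ^^ t) G))"

definition random_graph :: "nat \<Rightarrow> real \<Rightarrow> nat graph pmf" where
  "random_graph n p =
     map_pmf (\<lambda>X. ({..<n}, {e \<in> pairs {..<n}. X e}))
       (Pi_pmf (pairs {..<n}) False (\<lambda>_. bernoulli_pmf p))"

text \<open>The bound \<open>p \<le> 1\<close> makes \<open>p\<close> a probability; \<open>bernoulli_pmf\<close> is total and
  truncates its argument to the unit interval. The set always contains \<open>p = 1\<close>.\<close>

definition p_crit :: "nat \<Rightarrow> 'a graph \<Rightarrow> real" where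
  "p_crit n H = Inf {p. 0 < p \<and> p \<le> 1 \<and>
     measure_pmf.prob (random_graph n p)
       {G. perc_closure H G = complete_graph {..<n}} \<ge> 1 / 2}"

end

theory Submission
  imports Defs "HOL-Real_Asymp.Real_Asymp"
begin

text \<open>
  Write \<open>v\<close> and \<open>e\<close> for the numbers of vertices and edges of \<open>H\<close>, so that
  \<open>e = \<lambda> (v - 2) + 2\<close>. Balancedness says that every subgraph of \<open>H\<close> that misses an edge, on
  \<open>a \<ge> 2\<close> vertices, has at most \<open>\<lambda> (a - 2) + 1\<close> edges (\<open>sub_sparse\<close>), and \<open>H\<close> minus one edge
  attains this bound. The minimum degree gives \<open>\<lambda> \<ge> 1\<close>. Both halves of the theorem rest on
  these facts and on moment computations for structures whose size is a constant
  depending on \<open>\<epsilon>\<close> when \<open>p\<close> is compared with \<open>n powr (- 1 / \<lambda> \<plusminus> \<epsilon>)\<close>.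

  Lower bound. Run the process one edge at a time and keep the current edges partitioned into
  clusters, which at the start are the single edges of \<open>G\<close>. When a copy of \<open>H\<close> is completed,
  merge all clusters that it meets. Because a copy minus its new edge is as dense as a cluster
  has to be, and its overlap with each cluster is at most as dense, every cluster on \<open>u\<close> vertices
  always contains at least \<open>\<lambda> (u - 2) + 1\<close> edges of the original graph \<open>G\<close>
  (\<open>clustering_insert\<close>). A merge increases the size of clusters by a bounded factor only.
  Hence, if \<open>G\<close> percolates, then either the edge \<open>{0, 1}\<close> lies in such a dense vertex set of size
  less than a constant \<open>L\<close>, or there is a dense set whose size is between \<open>L\<close> and a constant
  multiple of \<open>L\<close> (\<open>closure_edge_in_small_dense_set\<close>). For \<open>p \<le> n powr (- 1 / \<lambda> - \<delta>)\<close> and a large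
  \<open>L\<close>, the expected numbers of both kinds of sets tend to \<open>0\<close> (\<open>percolation_prob_small\<close>).

  Upper bound. Chain \<open>k\<close> copies of \<open>H\<close>, each glued to the next along an edge which is then
  deleted. If the resulting ladder is present, then the copies are completed one after the other,
  and finally an edge at the root of the ladder is added. Each new copy contributes \<open>v - 2\<close> vertices
  and \<open>e - 2 = \<lambda> (v - 2)\<close> edges, so for \<open>q = n powr (- 1 / \<lambda> + \<epsilon>)\<close> the expected number of ladders at a
  given root grows with \<open>k\<close>. The same holds for every part of the ladder that contains the root
  (\<open>ladder_exists\<close>, \<open>ladder_many_copies\<close>), so the second moment method shows that a
  given edge is added with probability at least some \<open>c > 0\<close> (\<open>prob_edge_in_closure_ge\<close>). The
  union of about \<open>(2 / c) log n\<close> independent copies of the random graph then fails to produce a given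
  edge with probability at most \<open>1 / n\<^sup>2\<close>, and a union bound over the edges finishes the proof
  (\<open>percolation_prob_ge_half\<close>).
\<close>

section \<open>Sparse subgraphs of balanced graphs\<close>

text \<open>
  The form in which balancedness is used. It extends to pairs of vertices and to spanning
  subgraphs with a missing edge, so that overlaps of copies can be estimated uniformly.
\<close>
definition sub_sparse :: "real \<Rightarrow> 'a graph \<Rightarrow> bool" where
  "sub_sparse l F \<longleftrightarrow> simple_graph F
     \<and> real (card (edges F)) = l * (real (card (verts F)) - 2) + 2
     \<and> (\<forall>A D. A \<subseteq> verts F \<and> D \<subseteq> edges F \<and> D \<subseteq> pairs A \<and> D \<noteq> edges F \<and> 2 \<le> card A
          \<longrightarrow> real (card D) \<le> l * (real (card A) - 2) + 1)"

lemma sub_sparseD: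
  assumes "sub_sparse l F" "A \<subseteq> verts F" "D \<subseteq> edges F" "D \<subseteq> pairs A" "D \<noteq> edges F" "2 \<le> card A"
  shows "real (card D) \<le> l * (real (card A) - 2) + 1"
  using assms by (simp add: sub_sparse_def)

lemma pairs_mono: "A \<subseteq> B \<Longrightarrow> pairs A \<subseteq> pairs B"
  by (auto simp: pairs_def)

lemma finite_pairs: "finite A \<Longrightarrow> finite (pairs A)"
  by (simp add: pairs_def)

lemma card_pairs_le_power: "finite A \<Longrightarrow> card (pairs A) \<le> 2 ^ card A"
proof -
  assume A: "finite A"
  have "pairs A \<subseteq> Pow A" by (auto simp: pairs_def)
  then have "card (pairs A) \<le> card (Pow A)" using A by (intro card_mono) auto
  then show ?thesis using A by (simp add: card_Pow)
qed

lemma doubleton_in_pairs: "{x, y} \<in> pairs A \<longleftrightarrow> x \<in> A \<and> y \<in> A \<and> x \<noteq> y"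
  by (auto simp: pairs_def card_2_iff)

lemma pairs_card_two: "card A = 2 \<Longrightarrow> pairs A = {A}"
proof -
  assume A: "card A = 2"
  then have "finite A" using card.infinite by fastforce
  then show ?thesis using A card_subset_eq[of A] by (auto simp: pairs_def)
qed

lemma pairs_card_less_two: "finite A \<Longrightarrow> card A < 2 \<Longrightarrow> pairs A = {}"
  unfolding pairs_def by (auto dest: card_mono)

lemma image_mem_pairs: "inj_on f A \<Longrightarrow> e \<in> pairs A \<Longrightarrow> f ` e \<in> pairs (f ` A)"
  by (auto simp: pairs_def inj_on_subset card_image)

lemma simple_graphD:
  assumes "simple_graph F"
  shows "finite (verts F)" "finite (edges F)" "edges F \<subseteq> pairs (verts F)"
proof -
  show V: "finite (verts F)" and E: "edges F \<subseteq> pairs (verts F)"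
    using assms by (simp_all add: simple_graph_def)
  show "finite (edges F)" using E finite_pairs[OF V] by (rule finite_subset)
qed

lemma inj_on_image_edges:
  assumes "inj_on f V" "D \<subseteq> pairs V"
  shows "inj_on ((`) f) D"
proof (rule inj_onI)
  fix d e assume "d \<in> D" "e \<in> D" "f ` d = f ` e"
  moreover have "d \<subseteq> V" "e \<subseteq> V" using calculation assms(2) by (auto simp: pairs_def)
  ultimately show "d = e" using inj_on_image_eq_iff[OF assms(1)] by blast
qed

text \<open>
  Sets \<open>A\<close> of size strictly between 2 and \<open>card (verts H)\<close> are covered by balancedness. On
  two vertices there is at most one edge, and a proper subset of the edges has at most
  \<open>card (edges H) - 1 = lam H * (card (verts H) - 2) + 1\<close> elements.
\<close>
lemma balanced_imp_sub_sparse: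
  assumes H: "simple_graph H" "balanced H"
  shows "sub_sparse (lam H) H"
proof -
  note fin = simple_graphD[OF H(1)]
  have v4: "card (verts H) \<ge> 4" using H(2) by (simp add: balanced_def)
  have eq: "real (card (edges H)) = lam H * (real (card (verts H)) - 2) + 2"
    using v4 by (simp add: lam_def)
  have "real (card D) \<le> lam H * (real (card A) - 2) + 1"
    if A: "A \<subseteq> verts H" and D: "D \<subseteq> edges H" "D \<subseteq> pairs A" "D \<noteq> edges H" and c: "2 \<le> card A"
    for A D
  proof -
    have finA: "finite A" using A fin finite_subset by blast
    consider "card A = 2" | "3 \<le> card A" "card A < card (verts H)" | "card A = card (verts H)"
      using c card_mono[OF fin(1) A] by linarith
    then show ?thesis
    proof cases
      case 1
      then have "D \<subseteq> {A}" using D pairs_card_two by blast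
      then have "card D \<le> card {A}" by (intro card_mono) auto
      then show ?thesis using 1 by simp
    next
      case 2
      have "subgraph (A, D) H" using A D finA by (simp add: subgraph_def simple_graph_def)
      then have "(real (card D) - 1) / (real (card A) - 2) \<le> lam H"
        using H(2) 2 by (fastforce simp: balanced_def)
      then show ?thesis using 2 by (simp add: divide_le_eq)
    next
      case 3
      have "card D < card (edges H)" using D fin by (simp add: psubset_card_mono psubsetI)
      then show ?thesis using 3 eq by simp
    qed
  qed
  then show ?thesis using H eq unfolding sub_sparse_def by blast
qed

lemma sub_sparse_isomorphic:
  assumes H: "sub_sparse l H" and iso: "isomorphic H F"
  shows "sub_sparse l F"
proof -
  obtain f where f: "bij_betw f (verts H) (verts F)" and E: "edges F = (`) f ` edges H"
    using iso by (auto simp: isomorphic_def)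
  have sH: "simple_graph H" using H by (simp add: sub_sparse_def)
  note fin = simple_graphD[OF sH]
  have inj: "inj_on f (verts H)" and im: "f ` verts H = verts F"
    using f by (auto simp: bij_betw_def)
  have sF: "simple_graph F"
    unfolding simple_graph_def E im[symmetric]
  proof
    show "(`) f ` edges H \<subseteq> pairs (f ` verts H)" using fin(3) image_mem_pairs[OF inj] by (auto intro!: image_mem_pairs[OF inj])
  qed (use fin in simp)
  note finF = simple_graphD[OF sF]
  have cV: "card (verts F) = card (verts H)" using inj im card_image by metis
  have injE: "inj_on ((`) f) (edges H)" using inj fin(3) by (rule inj_on_image_edges)
  have cE: "card (edges F) = card (edges H)" using injE E card_image by metis
  have "real (card D) \<le> l * (real (card A) - 2) + 1"
    if A: "A \<subseteq> verts F" and D: "D \<subseteq> edges F" "D \<subseteq> pairs A" "D \<noteq> edges F" and c: "2 \<le> card A"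
    for A D
  proof -
    define A' where "A' = {v \<in> verts H. f v \<in> A}"
    define D' where "D' = {e \<in> edges H. f ` e \<in> D}"
    have fA: "f ` A' = A" using A im unfolding A'_def by auto
    have fD: "(`) f ` D' = D" using D E unfolding D'_def by auto
    have cA: "card A' = card A"
    proof -
      have "inj_on f A'" by (rule inj_on_subset[OF inj]) (auto simp: A'_def)
      then show ?thesis using fA card_image[of f A'] by simp
    qed
    have cD: "card D' = card D"
    proof -
      have "inj_on ((`) f) D'" by (rule inj_on_subset[OF injE]) (auto simp: D'_def)
      then show ?thesis using fD card_image[of "(`) f" D'] by simp
    qed
    have "D' \<subseteq> pairs A'"
    proof
      fix e assume e: "e \<in> D'"
      then have eH: "e \<in> pairs (verts H)" and fe: "f ` e \<in> D" using fin unfolding D'_def by auto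
      then have "f ` e \<subseteq> A" using D by (auto simp: pairs_def)
      then show "e \<in> pairs A'" using eH unfolding A'_def pairs_def by auto
    qed
    moreover have "D' \<noteq> edges H" using fD E D by blast
    moreover have "A' \<subseteq> verts H" "D' \<subseteq> edges H" by (auto simp: A'_def D'_def)
    ultimately have "real (card D') \<le> l * (real (card A') - 2) + 1"
      using H c cA unfolding sub_sparse_def by metis
    then show ?thesis using cA cD by simp
  qed
  then show ?thesis using H sF cV cE unfolding sub_sparse_def by metis
qed

text \<open>
  By the handshake identity, minimum degree 2 forces at least as many edges as vertices.
\<close>
lemma lam_ge_1:
  assumes H: "simple_graph H" and v: "card (verts H) \<ge> 4" and d: "min_degree H \<ge> 2"
  shows "lam H \<ge> 1"
proof -
  note fin = simple_graphD[OF H]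
  have deg: "2 \<le> degree H x" if "x \<in> verts H" for x
  proof -
    have "min_degree H \<le> degree H x" unfolding min_degree_def using that fin by simp
    then show ?thesis using d by linarith
  qed
  have "2 * card (verts H) = (\<Sum>x\<in>verts H. 2)" by simp
  also have "\<dots> \<le> (\<Sum>x\<in>verts H. card {e \<in> edges H. x \<in> e})"
    using deg by (intro sum_mono) (simp add: degree_def)
  also have "\<dots> = 2 * card (edges H)"
  proof (rule sum_multicount)
    show "\<forall>e\<in>edges H. card {x \<in> verts H. x \<in> e} = 2"
    proof
      fix e assume "e \<in> edges H"
      then have "e \<in> pairs (verts H)" using fin by blast
      then have "{x \<in> verts H. x \<in> e} = e" "card e = 2" by (auto simp: pairs_def)
      then show "card {x \<in> verts H. x \<in> e} = 2" by simp
    qed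
  qed (use fin in auto)
  finally have "card (verts H) \<le> card (edges H)" by simp
  then show ?thesis using v by (simp add: lam_def)
qed

section \<open>Closure properties of percolation\<close>

lemma verts_perc_iter [simp]: "verts ((perc_step H ^^ t) G) = verts G"
  by (induction t) (auto simp: perc_step_def)

lemma perc_iter_mono:
  assumes "s \<le> t"
  shows "edges ((perc_step H ^^ s) G) \<subseteq> edges ((perc_step H ^^ t) G)"
  using assms by (induction rule: dec_induct) (auto simp: perc_step_def)

lemma perc_closure_extensive: "edges G \<subseteq> edges (perc_closure H G)"
  unfolding perc_closure_def by (auto intro!: exI[of _ 0])

lemma verts_perc_closure [simp]: "verts (perc_closure H G) = verts G"
  by (simp add: perc_closure_def)

text \<open>
  Only finitely many edges of the copy have to be present, so all of them are present at some
  finite time, and the missing edge is added one step later at the latest.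
\<close>
lemma perc_closure_closed:
  fixes G :: "'b graph"
  assumes F: "isomorphic H F" "simple_graph F" "verts F \<subseteq> verts G"
    and e: "e \<in> edges F" and sub: "edges F - {e} \<subseteq> edges (perc_closure H G)"
  shows "e \<in> edges (perc_closure H G)"
proof -
  let ?G = "\<lambda>t. (perc_step H ^^ t) G"
  have "finite (edges F - {e})" using simple_graphD[OF F(2)] by simp
  moreover have "\<forall>d\<in>edges F - {e}. \<exists>t. d \<in> edges (?G t)"
    using sub by (auto simp: perc_closure_def)
  ultimately obtain \<tau> where \<tau>: "\<And>d. d \<in> edges F - {e} \<Longrightarrow> d \<in> edges (?G (\<tau> d))"
    by metis
  obtain N where N: "\<And>d. d \<in> edges F - {e} \<Longrightarrow> \<tau> d \<le> N"
    using finite_nat_set_iff_bounded_le[of "\<tau> ` (edges F - {e})"]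
      \<open>finite (edges F - {e})\<close> by auto
  have sN: "edges F - {e} \<subseteq> edges (?G N)" using \<tau> N perc_iter_mono by blast
  have "e \<in> edges (?G (Suc N))"
  proof (cases "e \<in> edges (?G N)")
    case True
    then show ?thesis using perc_iter_mono[of N "Suc N" H G] by (meson le_SucI order_refl subsetD)
  next
    case False
    have "subgraph F (add_edge e (?G N))" "\<not> subgraph F (?G N)"
      using F e sN False by (auto simp: subgraph_def add_edge_def)
    then have "creates_copy H (?G N) e" using F unfolding creates_copy_def by blast
    moreover have "e \<in> pairs (verts G)"
      using simple_graphD(3)[OF F(2)] e pairs_mono[OF F(3)] by blast
    ultimately show ?thesis using False by (simp add: perc_step_def)
  qed
  then show ?thesis unfolding perc_closure_def snd_conv by blast
qed

text \<open>
  A round of the process adds many edges at once. Since the copies completed in a round are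
  still completed if the edges of the round are added in any order, an invariant has to be
  checked for the insertion of a single edge only.
\<close>
lemma perc_iter_induct [consumes 1, case_names base add]:
  fixes G :: "'b graph"
  assumes G: "simple_graph G" and base: "P (edges G)"
    and add: "\<And>S e F. \<lbrakk>P S; edges G \<subseteq> S; e \<notin> S; isomorphic H F; simple_graph F;
      verts F \<subseteq> verts G; e \<in> edges F; edges F - {e} \<subseteq> S\<rbrakk> \<Longrightarrow> P (insert e S)"
  shows "P (edges ((perc_step H ^^ t) G))"
proof (induction t)
  case 0
  then show ?case using base by simp
next
  case (Suc t)
  define G' where "G' = (perc_step H ^^ t) G"
  have vG': "verts G' = verts G" by (simp add: G'_def)
  have GG': "edges G \<subseteq> edges G'"
    using perc_iter_mono[of 0 t H G] by (simp add: G'_def)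
  define N where "N = {e \<in> pairs (verts G). e \<notin> edges G' \<and> creates_copy H G' e}"
  have finN: "finite N"
    using finite_pairs[OF simple_graphD(1)[OF G]] unfolding N_def by simp
  have "P (edges G' \<union> M)" if "finite M" "M \<subseteq> N" for M
    using that
  proof (induction M rule: finite_induct)
    case empty
    then show ?case using Suc.IH by (simp add: G'_def)
  next
    case (insert e M)
    then have e: "e \<in> N" by simp
    obtain F where F: "isomorphic H F" "subgraph F (add_edge e G')" "\<not> subgraph F G'"
      using e unfolding N_def creates_copy_def by blast
    have sF: "simple_graph F" "verts F \<subseteq> verts G" "edges F - {e} \<subseteq> edges G'" "e \<in> edges F"
      using F vG' by (auto simp: subgraph_def add_edge_def)
    have "P (insert e (edges G' \<union> M))"
      by (rule add[where F = F]) (use insert sF F GG' e in \<open>auto simp: N_def\<close>)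
    then show ?case by simp
  qed
  from this[OF finN subset_refl] have "P (edges G' \<union> N)" .
  moreover have "edges (perc_step H G') = edges G' \<union> N"
    by (simp add: perc_step_def N_def vG')
  ultimately show ?case by (simp add: G'_def)
qed

lemma perc_closure_subset_pairs:
  assumes G: "simple_graph G"
  shows "edges (perc_closure H G) \<subseteq> pairs (verts G)"
proof -
  have "edges ((perc_step H ^^ t) G) \<subseteq> pairs (verts G)" for t
    using G
  proof (induction rule: perc_iter_induct)
    case (add S e F)
    then show ?case using pairs_mono[of "verts F" "verts G"] simple_graphD(3)[of F] by blast
  qed (use simple_graphD[OF G] in simp)
  then show ?thesis by (auto simp: perc_closure_def)
qed

text \<open>
  The closure of the larger graph contains the smaller graph and is closed under completing
  copies of \<open>H\<close>, hence it absorbs the whole process started from the smaller graph.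
\<close>
lemma perc_closure_mono:
  assumes G: "simple_graph G"
    and sub: "verts G = verts G'" "edges G \<subseteq> edges G'"
  shows "edges (perc_closure H G) \<subseteq> edges (perc_closure H G')"
proof -
  have "edges ((perc_step H ^^ t) G) \<subseteq> edges (perc_closure H G')" for t
    using G
  proof (induction rule: perc_iter_induct)
    case base
    then show ?case using sub perc_closure_extensive by blast
  next
    case (add S e F)
    have "e \<in> edges (perc_closure H G')"
      by (rule perc_closure_closed[where F = F]) (use add sub in auto)
    then show ?case using add by simp
  qed
  then show ?thesis by (auto simp: perc_closure_def)
qed

section \<open>Clusters and dense vertex sets\<close>

text \<open>
  The density that a set of vertices must have in order to be the span of a cluster.
\<close>
definition dense_on :: "real \<Rightarrow> 'b graph \<Rightarrow> 'b set \<Rightarrow> bool" where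
  "dense_on l G U \<longleftrightarrow> real (card (edges G \<inter> pairs U)) \<ge> l * (real (card U) - 2) + 1"

text \<open>
  The clusters partition the current edges \<open>S\<close>, whereas the density refers to the edges of the
  initial graph \<open>G\<close>. Distinct clusters are disjoint sets of edges, although their spans
  may share vertices.
\<close>
definition clustering :: "real \<Rightarrow> 'b graph \<Rightarrow> nat \<Rightarrow> 'b set set \<Rightarrow> 'b set set set \<Rightarrow> bool" where
  "clustering l G L S P \<longleftrightarrow> partition_on S P \<and>
     (\<forall>X\<in>P. card (\<Union>X) < L \<and> real (card (X \<inter> edges G)) \<ge> l * (real (card (\<Union>X)) - 2) + 1)"

text \<open>
  The new cluster \<open>Z\<close> consists of \<open>e\<close> and of the clusters \<open>X\<close> that meet the copy \<open>F\<close>. Let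
  \<open>W X\<close> be the part of the span of \<open>X\<close> inside \<open>F\<close>. The sets \<open>X \<inter> edges F\<close> partition the edges of
  \<open>F\<close> other than \<open>e\<close>, and each has at most \<open>l * (card (W X) - 2) + 1\<close> elements by sparseness.
  Passing from \<open>F\<close> to \<open>Z\<close>, a cluster adds at most \<open>card (\<Union>X) - card (W X)\<close> vertices, but at least
  \<open>l * (card (\<Union>X) - card (W X))\<close> more edges of \<open>G\<close> than it has edges in \<open>F\<close>. Thus the density
  survives. As at most \<open>card (edges F)\<close> clusters of span less than \<open>L\<close> are merged, the new span cannot
  jump over the sizes excluded by \<open>gap\<close>.
\<close>
lemma clustering_insert:
  fixes G :: "'b graph"
  assumes F: "sub_sparse l F" and l: "l \<ge> 0" and G: "simple_graph G"
    and vF: "verts F \<subseteq> verts G" and S: "S \<subseteq> pairs (verts G)" "edges G \<subseteq> S"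
    and e: "e \<notin> S" "e \<in> edges F" and sub: "edges F - {e} \<subseteq> S"
    and P: "clustering l G L S P"
    and gap: "\<And>U. \<lbrakk>U \<subseteq> verts G; L \<le> card U; card U \<le> card (edges F) * L + 2\<rbrakk>
                 \<Longrightarrow> \<not> dense_on l G U"
  shows "\<exists>P'. clustering l G L (insert e S) P'"
proof -
  have sF: "simple_graph F" using F by (simp add: sub_sparse_def)
  note finF = simple_graphD[OF sF] and finG = simple_graphD[OF G]
  have part: "\<Union>P = S" "disjoint P" "{} \<notin> P"
    using P by (auto simp: clustering_def partition_on_def)
  have finS: "finite S" using S finite_pairs[OF finG(1)] finite_subset by blast
  have finP: "finite P" using part finS finite_UnionD by blast
  have small: "card (\<Union>X) < L" and dens: "real (card (X \<inter> edges G)) \<ge> l * (real (card (\<Union>X)) - 2) + 1"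
    if "X \<in> P" for X
    using P that by (auto simp: clustering_def)
  define Q where "Q = {X \<in> P. X \<inter> edges F \<noteq> {}}"
  define Z where "Z = insert e (\<Union>Q)"
  define W where "W = (\<lambda>X. \<Union>X \<inter> verts F)"
  have QP: "Q \<subseteq> P" by (auto simp: Q_def)
  have finQ: "finite Q" using QP finP finite_subset by blast
  have XS: "X \<subseteq> S" if "X \<in> Q" for X using that QP part by blast
  have finX: "finite X" if "X \<in> Q" for X using XS[OF that] finS finite_subset by blast
  have UX: "\<Union>X \<subseteq> verts G" if "X \<in> Q" for X
    using XS[OF that] S(1) unfolding pairs_def by blast
  have finUX: "finite (\<Union>X)" if "X \<in> Q" for X
    using UX[OF that] finG(1) by (rule finite_subset)
  have disj: "X \<inter> Y = {}" if "X \<in> Q" "Y \<in> Q" "X \<noteq> Y" for X Y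
    using that QP part(2) by (meson disjointD subsetD)
  have eF: "e \<in> pairs (verts F)" using e finF by blast
  have cD: "real (card (X \<inter> edges F)) \<le> l * (real (card (W X)) - 2) + 1" if X: "X \<in> Q" for X
  proof -
    have D: "X \<inter> edges F \<subseteq> pairs (W X)"
      using finF(3) unfolding W_def pairs_def by blast
    obtain d where d: "d \<in> X \<inter> edges F" using X by (auto simp: Q_def)
    then have "d \<subseteq> W X" "card d = 2" using D by (auto simp: pairs_def)
    moreover have "finite (W X)" using finF(1) by (simp add: W_def)
    ultimately have "2 \<le> card (W X)" using card_mono[of "W X" d] by simp
    moreover have "X \<inter> edges F \<noteq> edges F" using e XS[OF X] by blast
    moreover have "W X \<subseteq> verts F" by (simp add: W_def)
    ultimately show ?thesis using sub_sparseD[OF F _ Int_lower2 D] by blast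
  qed
  have sumD: "card (edges F) - 1 = (\<Sum>X\<in>Q. card (X \<inter> edges F))"
  proof -
    have "edges F - {e} = (\<Union>X\<in>Q. X \<inter> edges F)"
    proof
      show "edges F - {e} \<subseteq> (\<Union>X\<in>Q. X \<inter> edges F)" using sub part(1) unfolding Q_def by blast
      show "(\<Union>X\<in>Q. X \<inter> edges F) \<subseteq> edges F - {e}" using XS e(1) by blast
    qed
    then have "card (edges F - {e}) = card (\<Union>X\<in>Q. X \<inter> edges F)" by simp
    also have "\<dots> = (\<Sum>X\<in>Q. card (X \<inter> edges F))"
      by (rule card_UN_disjoint) (use finQ finX disj in blast)+
    finally show ?thesis using e by simp
  qed
  have cardF1: "card (edges F) \<ge> 1" using e finF by (metis One_nat_def Suc_leI card_gt_0_iff empty_iff)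
  have sumB: "card (Z \<inter> edges G) = (\<Sum>X\<in>Q. card (X \<inter> edges G))"
  proof -
    have "Z \<inter> edges G = (\<Union>X\<in>Q. X \<inter> edges G)" using e S unfolding Z_def by blast
    also have "card \<dots> = (\<Sum>X\<in>Q. card (X \<inter> edges G))"
      by (rule card_UN_disjoint) (use finQ finX disj in blast)+
    finally show ?thesis .
  qed
  have WU: "card (W X) \<le> card (\<Union>X)" if "X \<in> Q" for X
    unfolding W_def using finUX[OF that] by (intro card_mono) auto
  have cU: "card (\<Union>Z) \<le> card (verts F) + (\<Sum>X\<in>Q. card (\<Union>X) - card (W X))"
  proof -
    have "\<Union>Z \<subseteq> verts F \<union> (\<Union>X\<in>Q. \<Union>X - W X)"
      using eF unfolding Z_def W_def pairs_def by blast
    then have "card (\<Union>Z) \<le> card (verts F \<union> (\<Union>X\<in>Q. \<Union>X - W X))"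
      using finF(1) finQ finUX by (intro card_mono) auto
    also have "\<dots> \<le> card (verts F) + card (\<Union>X\<in>Q. \<Union>X - W X)" by (rule card_Un_le)
    also have "\<dots> \<le> card (verts F) + (\<Sum>X\<in>Q. card (\<Union>X - W X))"
      using card_UN_le[OF finQ] by simp
    also have "(\<Sum>X\<in>Q. card (\<Union>X - W X)) = (\<Sum>X\<in>Q. card (\<Union>X) - card (W X))"
    proof (rule sum.cong)
      fix X assume "X \<in> Q"
      then show "card (\<Union>X - W X) = card (\<Union>X) - card (W X)"
        using finF(1) by (intro card_Diff_subset) (auto simp: W_def)
    qed simp
    finally show ?thesis .
  qed
  have cUr: "real (card (\<Union>Z)) \<le> real (card (verts F)) + (\<Sum>X\<in>Q. real (card (\<Union>X)) - real (card (W X)))"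
  proof -
    have "real (card (\<Union>Z)) \<le> real (card (verts F) + (\<Sum>X\<in>Q. card (\<Union>X) - card (W X)))"
      using cU by linarith
    also have "\<dots> = real (card (verts F)) + (\<Sum>X\<in>Q. real (card (\<Union>X)) - real (card (W X)))"
      using WU by (simp add: of_nat_diff)
    finally show ?thesis .
  qed
  \<comment> \<open>the \<open>- 1\<close> for the edge \<open>e\<close>, which is not in \<open>G\<close>, turns \<open>l * (card (verts F) - 2) + 2\<close> into the density of a cluster\<close>
  have densZ: "real (card (Z \<inter> edges G)) \<ge> l * (real (card (\<Union>Z)) - 2) + 1"
  proof -
    have eqF: "real (card (edges F)) = l * (real (card (verts F)) - 2) + 2"
      using F by (simp add: sub_sparse_def)
    have "l * (real (card (\<Union>Z)) - 2) + 1
        \<le> l * (real (card (verts F)) + (\<Sum>X\<in>Q. real (card (\<Union>X)) - real (card (W X))) - 2) + 1"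
      using cUr l by (intro add_right_mono mult_left_mono) auto
    also have "\<dots> = real (card (edges F)) - 1 + (\<Sum>X\<in>Q. l * (real (card (\<Union>X)) - real (card (W X))))"
      using eqF by (simp add: algebra_simps sum_distrib_left)
    also have "real (card (edges F)) - 1 = (\<Sum>X\<in>Q. real (card (X \<inter> edges F)))"
      using sumD cardF1 by (metis of_nat_1 of_nat_diff of_nat_sum)
    also have "\<dots> + (\<Sum>X\<in>Q. l * (real (card (\<Union>X)) - real (card (W X))))
        = (\<Sum>X\<in>Q. real (card (X \<inter> edges F)) + l * (real (card (\<Union>X)) - real (card (W X))))"
      by (simp add: sum.distrib)
    also have "\<dots> \<le> (\<Sum>X\<in>Q. real (card (X \<inter> edges G)))"
    proof (rule sum_mono)
      fix X assume X: "X \<in> Q"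
      then show "real (card (X \<inter> edges F)) + l * (real (card (\<Union>X)) - real (card (W X)))
          \<le> real (card (X \<inter> edges G))"
        using cD[OF X] dens[of X] QP by (auto simp: algebra_simps)
    qed
    finally show ?thesis using sumB by simp
  qed
  have smallZ: "card (\<Union>Z) < L"
  proof (rule ccontr)
    assume big: "\<not> card (\<Union>Z) < L"
    have ZG: "\<Union>Z \<subseteq> verts G" using eF vF UX unfolding Z_def pairs_def by blast
    have "\<Union>Z \<subseteq> e \<union> (\<Union>X\<in>Q. \<Union>X)" unfolding Z_def by blast
    then have "card (\<Union>Z) \<le> card (e \<union> (\<Union>X\<in>Q. \<Union>X))"
      using finUX finQ eF finF(1) by (intro card_mono) (auto simp: pairs_def finite_subset)
    also have "\<dots> \<le> card e + card (\<Union>X\<in>Q. \<Union>X)" by (rule card_Un_le)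
    also have "\<dots> \<le> 2 + (\<Sum>X\<in>Q. card (\<Union>X))"
      using card_UN_le[OF finQ, of Union] eF by (simp add: pairs_def)
    also have "(\<Sum>X\<in>Q. card (\<Union>X)) \<le> (\<Sum>X\<in>Q. card (X \<inter> edges F) * L)"
    proof (rule sum_mono)
      fix X assume X: "X \<in> Q"
      then have "1 \<le> card (X \<inter> edges F)"
        using finX[OF X] by (auto simp: Q_def Suc_le_eq card_gt_0_iff)
      then have "1 * L \<le> card (X \<inter> edges F) * L" by (intro mult_right_mono) auto
      then show "card (\<Union>X) \<le> card (X \<inter> edges F) * L"
        using small[OF subsetD[OF QP X]] by linarith
    qed
    also have "\<dots> = (card (edges F) - 1) * L" unfolding sumD by (simp add: sum_distrib_right)
    also have "\<dots> \<le> card (edges F) * L" by simp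
    finally have "card (\<Union>Z) \<le> card (edges F) * L + 2" by simp
    then have "\<not> dense_on l G (\<Union>Z)" using gap[OF ZG] big by simp
    moreover have "Z \<inter> edges G \<subseteq> edges G \<inter> pairs (\<Union>Z)"
      using finG(3) unfolding pairs_def by blast
    then have "card (Z \<inter> edges G) \<le> card (edges G \<inter> pairs (\<Union>Z))"
      using finG(2) by (intro card_mono) auto
    ultimately show False using densZ unfolding dense_on_def by linarith
  qed
  have "partition_on (insert e S) (insert Z (P - Q))"
  proof (rule partition_onI)
    show "\<Union>(insert Z (P - Q)) = insert e S" using part(1) QP unfolding Z_def by blast
    show "disjnt p q" if "p \<in> insert Z (P - Q)" "q \<in> insert Z (P - Q)" "p \<noteq> q" for p q
    proof -
      have ZX: "disjnt Z X" if "X \<in> P - Q" for X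
      proof -
        have "e \<notin> X" using that part(1) e(1) by blast
        moreover have "Y \<inter> X = {}" if "Y \<in> Q" for Y
          using that \<open>X \<in> P - Q\<close> QP disjointD[OF part(2), of Y X] by blast
        ultimately show ?thesis unfolding Z_def disjnt_def by blast
      qed
      show ?thesis
        using that ZX[of p] ZX[of q] disjointD[OF part(2), of p q] unfolding disjnt_def by blast
    qed
    show "{} \<notin> insert Z (P - Q)" using part(3) unfolding Z_def by blast
  qed
  then have "clustering l G L (insert e S) (insert Z (P - Q))"
    using small dens smallZ densZ unfolding clustering_def by blast
  then show ?thesis by blast
qed

text \<open>
  The clusters start as single edges, which attain the density bound with equality, and
  \<open>clustering_insert\<close> maintains them until the given edge is added. Its cluster then spans the
  required set.
\<close>
lemma closure_edge_in_small_dense_set: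
  fixes G :: "'b graph"
  assumes H: "sub_sparse l H" and l: "l \<ge> 0" and G: "simple_graph G" and L: "L \<ge> 3"
    and gap: "\<And>U. \<lbrakk>U \<subseteq> verts G; L \<le> card U; card U \<le> card (edges H) * L + 2\<rbrakk>
                 \<Longrightarrow> \<not> dense_on l G U"
    and e: "e \<in> edges (perc_closure H G)"
  shows "\<exists>U. e \<subseteq> U \<and> U \<subseteq> verts G \<and> card U < L \<and> dense_on l G U"
proof -
  have sH: "simple_graph H" using H by (simp add: sub_sparse_def)
  note finG = simple_graphD[OF G]
  have inv: "edges ((perc_step H ^^ t) G) \<subseteq> pairs (verts G)
      \<and> (\<exists>P. clustering l G L (edges ((perc_step H ^^ t) G)) P)" for t
    using G
  proof (induction rule: perc_iter_induct)
    case base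
    have "clustering l G L (edges G) ((\<lambda>e. {e}) ` edges G)"
      unfolding clustering_def
    proof (intro conjI ballI)
      show "partition_on (edges G) ((\<lambda>e. {e}) ` edges G)"
        by (auto simp: partition_on_def disjoint_def)
      fix X assume "X \<in> (\<lambda>e. {e}) ` edges G"
      then obtain d where d: "X = {d}" "d \<in> edges G" by blast
      then have "card d = 2" using finG by (auto simp: pairs_def)
      then show "card (\<Union>X) < L" "real (card (X \<inter> edges G)) \<ge> l * (real (card (\<Union>X)) - 2) + 1"
        using d L by auto
    qed
    then show ?case using finG by blast
  next
    case (add S e F)
    then obtain P where P: "clustering l G L S P" and S: "S \<subseteq> pairs (verts G)" by blast
    have F: "sub_sparse l F" using sub_sparse_isomorphic H add by blast
    have "card (edges F) = card (edges H)"
    proof -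
      obtain f where f: "bij_betw f (verts H) (verts F)" "edges F = (`) f ` edges H"
        using \<open>isomorphic H F\<close> by (auto simp: isomorphic_def)
      then show ?thesis
        using inj_on_image_edges[OF bij_betw_imp_inj_on[OF f(1)] simple_graphD(3)[OF sH]]
        by (simp add: card_image)
    qed
    then have "\<exists>P'. clustering l G L (insert e S) P'"
      using clustering_insert[OF F l G _ S _ _ _ _ P] add gap by simp
    moreover have "e \<in> pairs (verts G)"
      using add pairs_mono[of "verts F" "verts G"] simple_graphD(3)[of F] by blast
    ultimately show ?case using S by blast
  qed
  obtain t where t: "e \<in> edges ((perc_step H ^^ t) G)" using e by (auto simp: perc_closure_def)
  obtain P where P: "clustering l G L (edges ((perc_step H ^^ t) G)) P"
    and sub: "edges ((perc_step H ^^ t) G) \<subseteq> pairs (verts G)"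
    using inv by blast
  obtain X where X: "X \<in> P" "e \<in> X" using P t by (auto simp: clustering_def partition_on_def)
  have XP: "X \<subseteq> pairs (verts G)" using X P sub by (auto simp: clustering_def partition_on_def)
  have "X \<inter> edges G \<subseteq> edges G \<inter> pairs (\<Union>X)" using finG(3) unfolding pairs_def by blast
  then have "card (X \<inter> edges G) \<le> card (edges G \<inter> pairs (\<Union>X))"
    using finG(2) by (intro card_mono) auto
  then have "dense_on l G (\<Union>X)" using P X unfolding clustering_def dense_on_def by force
  moreover have "\<Union>X \<subseteq> verts G" using XP unfolding pairs_def by blast
  moreover have "card (\<Union>X) < L" using P X by (simp add: clustering_def)
  ultimately show ?thesis using X by blast
qed

section \<open>Ladders\<close>

text \<open>
  These bounds control one rung of a ladder, whose rungs are copies of \<open>H\<close> with two edges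
  removed: \<open>e\<close> is the edge towards the root and \<open>d\<close> the edge towards the rest of the ladder. Vertices in
  \<open>e\<close> are not counted, as they belong to the previous rung. If \<open>A\<close> contains \<open>e\<close>, then two
  vertices are not counted, but the removal of \<open>e\<close> compensates the additive constant in
  \<open>sub_sparse\<close>; otherwise at most one vertex is not counted, and \<open>l \<ge> 1\<close> compensates it. If \<open>A\<close>
  contains \<open>d\<close> but not \<open>e\<close>, then both savings occur.
\<close>
lemma sub_sparse_edges_minus_two:
  assumes F: "sub_sparse l F" and l: "l \<ge> 1"
    and d: "d \<in> edges F" and e: "e \<in> edges F" and de: "d \<noteq> e" and A: "A \<subseteq> verts F"
  shows "real (card ((edges F - {d, e}) \<inter> pairs A)) \<le> l * real (card (A - e))" (is ?A)
    and "d \<subseteq> A \<Longrightarrow> \<not> e \<subseteq> A \<Longrightarrow>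
          real (card ((edges F - {d, e}) \<inter> pairs A)) \<le> l * real (card (A - e)) - 1" (is "_ \<Longrightarrow> _ \<Longrightarrow> ?B")
proof -
  have sF: "simple_graph F" using F by (simp add: sub_sparse_def)
  note fin = simple_graphD[OF sF]
  have finA: "finite A" using A fin(1) by (rule finite_subset)
  have c2: "card d = 2" "card e = 2" using d e fin(3) by (auto simp: pairs_def)
  have finE: "finite e" using c2 by (metis card.infinite zero_neq_numeral)
  let ?D = "(edges F - {d, e}) \<inter> pairs A"
  have Ae: "real (card A) - real (card (A \<inter> e)) = real (card (A - e))"
    using finA by (simp add: card_Diff_subset_Int card_mono of_nat_diff)
  have plain: "real (card ?D) \<le> l * (real (card A) - 2) + 1" if "2 \<le> card A"
    by (rule sub_sparseD[OF F A _ _ _ that]) (use d in blast)+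
  \<comment> \<open>a removed edge that lies inside \<open>A\<close> improves the bound by one\<close>
  have better: "real (card ?D) \<le> l * (real (card A) - 2)" if xy: "{x, y} = {d, e}" and x: "x \<subseteq> A" for x y
  proof -
    have x': "x \<in> edges F" "y \<in> edges F" "card x = 2" "x \<noteq> y" using xy c2 d e de by (auto simp: doubleton_eq_iff)
    have cA: "2 \<le> card A" using x x' finA card_mono by metis
    have "real (card (insert x ?D)) \<le> l * (real (card A) - 2) + 1"
    proof (rule sub_sparseD[OF F A _ _ _ cA])
      show "insert x ?D \<subseteq> pairs A" using x x' by (auto simp: pairs_def)
      have "y \<notin> insert x ?D" using xy x' by auto
      then show "insert x ?D \<noteq> edges F" using x' by blast
    qed (use x' in blast)
    moreover have "card (insert x ?D) = Suc (card ?D)"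
      using fin(2) xy by (subst card_insert_disjoint) auto
    ultimately show ?thesis by simp
  qed
  show ?A
  proof -
    consider "e \<subseteq> A" | "card (A \<inter> e) \<le> 1" "2 \<le> card A" | "card A < 2"
    proof -
      have "e \<subseteq> A" if "\<not> card (A \<inter> e) \<le> 1"
      proof -
        have "card e \<le> card (A \<inter> e)" using that c2 by simp
        then have "A \<inter> e = e" using finE by (metis Int_lower2 card_seteq)
        then show ?thesis by blast
      qed
      then show ?thesis using that by linarith
    qed
    then show ?thesis
    proof cases
      case 1
      then have "card (A \<inter> e) = 2" using c2 by (simp add: Int_absorb1)
      then show ?thesis using better[of e d] 1 Ae by auto
    next
      case 2
      have "l * (real (card A) - 2) + 1 \<le> l * (real (card A) - 1)" using l by (simp add: algebra_simps)
      also have "\<dots> \<le> l * real (card (A - e))" using 2 Ae l by (intro mult_left_mono) auto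
      finally show ?thesis using plain 2 by linarith
    next
      case 3
      then have "?D = {}" using pairs_card_less_two[OF finA] by blast
      then have "card ?D = 0" by simp
      then show ?thesis using l by simp
    qed
  qed
  show ?B if dA: "d \<subseteq> A" and eA: "\<not> e \<subseteq> A"
  proof -
    have "A \<inter> e \<subset> e" using eA by blast
    then have "card (A \<inter> e) \<le> 1" using psubset_card_mono[OF finE, of "A \<inter> e"] c2 by simp
    then have "l * (real (card A) - 1) \<le> l * real (card (A - e))" using Ae l by (intro mult_left_mono) auto
    then have "l * (real (card A) - 2) \<le> l * real (card (A - e)) - l" by (simp add: algebra_simps)
    then show ?thesis using better[OF refl dA] l by linarith
  qed
qed

text \<open>
  All hosts and embeddings are quantified at once, so that the property of a ladder can be
  applied inside a longer ladder.
\<close>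
definition infects :: "'a graph \<Rightarrow> nat graph \<Rightarrow> nat set \<Rightarrow> bool" where
  "infects H L R \<longleftrightarrow> (\<forall>(G::nat graph) \<phi>. simple_graph G \<longrightarrow> inj_on \<phi> (verts L) \<longrightarrow> \<phi> ` verts L \<subseteq> verts G \<longrightarrow>
      (`) \<phi> ` edges L \<subseteq> edges G \<longrightarrow> \<phi> ` R \<in> edges (perc_closure H G))"

text \<open>
  Up to the additive term, this says that the part of \<open>L\<close> on \<open>W\<close> is expected to occur often at a
  given root when the edge probability is slightly above \<open>n powr (- 1 / l)\<close>. The additional edge is
  allowed only together with at least \<open>k\<close> vertices outside the root, whose surplus then pays for it. Sets
  \<open>W\<close> that do not contain the root are included to make the induction on the ladder work.
\<close>
definition rooted_sparse :: "real \<Rightarrow> nat \<Rightarrow> nat graph \<Rightarrow> nat set \<Rightarrow> bool" where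
  "rooted_sparse l k L R \<longleftrightarrow> (\<forall>W\<subseteq>verts L.
     real (card (edges L \<inter> pairs W)) \<le> l * real (card (W - R)) \<or>
     (R \<subseteq> W \<and> k + 2 \<le> card W \<and> real (card (edges L \<inter> pairs W)) \<le> l * real (card (W - R)) + 1))"

text \<open>
  Used for gluing a fresh copy of \<open>H\<close> along an edge: it meets the existing vertices \<open>P\<close> exactly
  in the prescribed pair.
\<close>
lemma isomorphic_copy_through:
  fixes H :: "'a graph" and P :: "nat set"
  assumes H: "simple_graph H" and e: "e \<in> edges H" and R: "card R = 2" and P: "finite P" "R \<subseteq> P"
  shows "\<exists>f. inj_on f (verts H) \<and> f ` e = R \<and> f ` verts H \<inter> P = R"
proof -
  note fin = simple_graphD[OF H]
  have eV: "e \<subseteq> verts H" "card e = 2" using fin e by (auto simp: pairs_def)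
  have finR: "finite R" using P finite_subset by blast
  have finE: "finite e" using eV fin finite_subset by blast
  obtain g where g: "bij_betw g e R" using finite_same_card_bij[OF finE finR] eV R by auto
  obtain h where h: "inj_on h (verts H)" "h ` verts H \<subseteq> - P"
  proof -
    have "infinite (- P)" using P by (simp add: finite_compl)
    then obtain B where B: "B \<subseteq> - P" "finite B" "card B = card (verts H)"
      using infinite_arbitrarily_large by metis
    then obtain h where "bij_betw h (verts H) B" using finite_same_card_bij[OF fin(1) B(2)] by auto
    then show ?thesis using that B by (auto simp: bij_betw_def)
  qed
  define f where "f = (\<lambda>v. if v \<in> e then g v else h v)"
  have fe: "f ` e = R" using g unfolding f_def bij_betw_def by auto
  have fo: "f v \<notin> P" if "v \<in> verts H - e" for v using that h unfolding f_def by auto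
  have "inj_on f (verts H)"
  proof (rule inj_onI)
    fix u v assume uv: "u \<in> verts H" "v \<in> verts H" "f u = f v"
    have "u \<in> e \<longleftrightarrow> v \<in> e" using uv fo fe P by (metis DiffI image_eqI subsetD)
    then show "u = v"
      using uv h g unfolding f_def bij_betw_def inj_on_def by (metis (full_types))
  qed
  moreover have "f ` verts H \<inter> P = R" using fe fo eV P by blast
  ultimately show ?thesis using fe by blast
qed

text \<open>
  Induction on the number of rungs. The ladder without rungs is a single edge. A further rung
  is a copy of \<open>H\<close> in which \<open>d\<close> is identified with the old root, \<open>e\<close> becomes the new root, and both
  edges are removed: the old ladder supplies \<open>d\<close>, and then the copy of \<open>H\<close> supplies \<open>e\<close>. For the
  sparseness, the additive 1 can come from the old ladder only. In that case the old root lies in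
  \<open>W\<close>, so either the new root does as well and has a vertex outside the old ladder, which makes \<open>W\<close>
  larger, or the second bound of \<open>sub_sparse_edges_minus_two\<close> absorbs the 1.
\<close>
lemma ladder_exists:
  fixes H :: "'a graph"
  assumes H: "sub_sparse l H" and l: "l \<ge> 1"
    and d: "d \<in> edges H" and e: "e \<in> edges H" and de: "d \<noteq> e"
  shows "\<exists>L R. simple_graph L \<and> R \<in> pairs (verts L) \<and> rooted_sparse l k L R \<and> infects H L R"
proof (induction k)
  case 0
  have "simple_graph ({0, 1}, {{0, 1}} :: nat set set)" by (simp add: simple_graph_def doubleton_in_pairs)
  moreover have "rooted_sparse l 0 ({0, 1}, {{0, 1}}) {0, 1::nat}"
    unfolding rooted_sparse_def
  proof (intro allI impI)
    fix W :: "nat set"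
    assume W: "W \<subseteq> verts ({0, 1}, {{0, 1}} :: nat set set)"
    show "real (card (edges ({0, 1}, {{0, 1}}) \<inter> pairs W)) \<le> l * real (card (W - {0, 1})) \<or>
     ({0, 1} \<subseteq> W \<and> 0 + 2 \<le> card W \<and>
      real (card (edges ({0, 1}, {{0, 1}}) \<inter> pairs W)) \<le> l * real (card (W - {0, 1})) + 1)"
    proof (cases "{0, 1} \<subseteq> W")
      case True
      then have "W = {0, 1}" using W by auto
      then show ?thesis by (simp add: pairs_card_two)
    next
      case False
      then have "edges ({0, 1}, {{0, 1}} :: nat set set) \<inter> pairs W = {}" by (auto simp: pairs_def)
      then have "card (edges ({0, 1}, {{0, 1}} :: nat set set) \<inter> pairs W) = 0" by simp
      then show ?thesis using l by simp
    qed
  qed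
  moreover have "infects H ({0, 1}, {{0, 1}}) {0, 1::nat}"
    unfolding infects_def
  proof (intro allI impI)
    fix G :: "nat graph" and \<phi> :: "nat \<Rightarrow> nat"
    assume "(`) \<phi> ` edges ({0, 1}, {{0, 1}}) \<subseteq> edges G"
    then have "\<phi> ` {0, 1} \<in> edges G" by simp
    then show "\<phi> ` {0, 1} \<in> edges (perc_closure H G)"
      using perc_closure_extensive[of G H] by blast
  qed
  moreover have "{0, 1} \<in> pairs (verts ({0, 1}, {{0, 1}} :: nat set set))"
    by (simp add: doubleton_in_pairs)
  ultimately show ?case by blast
next
  case (Suc k)
  then obtain L R where L: "simple_graph L" and RL: "R \<in> pairs (verts L)"
    and sparse: "rooted_sparse l k L R" and inf: "infects H L R" by blast
  have sH: "simple_graph H" using H by (simp add: sub_sparse_def)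
  note finH = simple_graphD[OF sH] and finL = simple_graphD[OF L]
  have cR: "card R = 2" "R \<subseteq> verts L" using RL by (auto simp: pairs_def)
  obtain f where f: "inj_on f (verts H)" and fd: "f ` d = R" and fV: "f ` verts H \<inter> verts L = R"
    using isomorphic_copy_through[OF sH d cR(1) finL(1) cR(2)] by blast
  define F where "F = (f ` verts H, (`) f ` edges H)"
  define R' where "R' = f ` e"
  have iso: "isomorphic H F" unfolding isomorphic_def F_def using f by (auto simp: bij_betw_def)
  have F: "sub_sparse l F" using sub_sparse_isomorphic[OF H iso] .
  have sF: "simple_graph F" using F by (simp add: sub_sparse_def)
  note finF = simple_graphD[OF sF]
  have RF: "R \<in> edges F" "R' \<in> edges F" using d e fd by (auto simp: F_def R'_def)
  have RR': "R \<noteq> R'"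
    using inj_on_image_edges[OF f finH(3)] d e de fd unfolding R'_def inj_on_def by blast
  have R'F: "R' \<subseteq> verts F" "card R' = 2" using RF finF by (auto simp: pairs_def)
  have VV: "verts F \<inter> verts L = R" using fV by (simp add: F_def)
  define L' where "L' = (verts F \<union> verts L, (edges F - {R, R'}) \<union> edges L)"
  have vL': "verts L' = verts F \<union> verts L" and eL': "edges L' = (edges F - {R, R'}) \<union> edges L"
    by (simp_all add: L'_def)
  have sL': "simple_graph L'"
    unfolding simple_graph_def vL' eL'
    using finF finL pairs_mono[of "verts F" "verts F \<union> verts L"] pairs_mono[of "verts L" "verts F \<union> verts L"]
    by blast
  have "R' \<in> pairs (verts L')" using R'F by (auto simp: pairs_def vL')
  moreover have "rooted_sparse l (Suc k) L' R'"
    unfolding rooted_sparse_def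
  proof (intro allI impI)
    fix W assume W: "W \<subseteq> verts L'"
    define A where "A = W \<inter> verts F"
    define B where "B = W \<inter> verts L"
    let ?a = "card ((edges F - {R, R'}) \<inter> pairs A)" and ?b = "card (edges L \<inter> pairs B)"
    have finA: "finite A" and finB: "finite B" using finF finL by (auto simp: A_def B_def)
    have finW: "finite W" using W finF finL by (auto simp: vL' finite_subset)
    have cnt: "card (edges L' \<inter> pairs W) \<le> ?a + ?b"
    proof -
      have "edges L' \<inter> pairs W \<subseteq> ((edges F - {R, R'}) \<inter> pairs A) \<union> (edges L \<inter> pairs B)"
        using finF(3) finL(3) unfolding eL' A_def B_def pairs_def by blast
      then have "card (edges L' \<inter> pairs W) \<le> card (((edges F - {R, R'}) \<inter> pairs A) \<union> (edges L \<inter> pairs B))"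
        using finF finL by (intro card_mono) auto
      then show ?thesis using card_Un_le order_trans by blast
    qed
    have "W - R' = (A - R') \<union> (B - R)" "(A - R') \<inter> (B - R) = {}"
      using W VV R'F unfolding A_def B_def vL' by blast+
    then have cW: "card (W - R') = card (A - R') + card (B - R)"
      using finA finB by (simp add: card_Un_disjoint)
    have AF: "A \<subseteq> verts F" by (simp add: A_def)
    note partF = sub_sparse_edges_minus_two[OF F l RF RR' AF]
    have partL: "real ?b \<le> l * real (card (B - R)) \<or>
       (R \<subseteq> B \<and> k + 2 \<le> card B \<and> real ?b \<le> l * real (card (B - R)) + 1)"
      using sparse[unfolded rooted_sparse_def, rule_format, of B] by (simp add: B_def)
    have add: "l * real (card (W - R')) = l * real (card (A - R')) + l * real (card (B - R))"
      by (simp add: cW algebra_simps)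
    show "real (card (edges L' \<inter> pairs W)) \<le> l * real (card (W - R')) \<or>
       (R' \<subseteq> W \<and> Suc k + 2 \<le> card W \<and> real (card (edges L' \<inter> pairs W)) \<le> l * real (card (W - R')) + 1)"
    proof (cases "real ?b \<le> l * real (card (B - R))")
      case True
      then show ?thesis using partF(1) cnt add by linarith
    next
      case False
      then have B: "R \<subseteq> B" "k + 2 \<le> card B" "real ?b \<le> l * real (card (B - R)) + 1" using partL by auto
      have RA: "R \<subseteq> A" using B(1) VV by (auto simp: A_def B_def)
      show ?thesis
      proof (cases "R' \<subseteq> A")
        case False
        then show ?thesis using partF(2)[OF RA] B cnt add by linarith
      next
        case True
        have "\<not> R' \<subseteq> R"
          using RR' R'F cR by (metis card_subset_eq card.infinite zero_neq_numeral)
        then have "\<not> R' \<subseteq> B" using VV R'F by (auto simp: B_def)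
        then have "B \<subset> W" using True by (auto simp: A_def B_def)
        then have "card B < card W" using finW by (rule psubset_card_mono[rotated])
        moreover have "R' \<subseteq> W" using True by (simp add: A_def)
        moreover have "real (card (edges L' \<inter> pairs W)) \<le> l * real (card (W - R')) + 1"
          using partF(1) B(3) cnt add by linarith
        ultimately show ?thesis using B(2) by linarith
      qed
    qed
  qed
  moreover have "infects H L' R'"
    unfolding infects_def
  proof (intro allI impI)
    fix G :: "nat graph" and \<phi>
    assume G: "simple_graph G" and inj: "inj_on \<phi> (verts L')"
      and V: "\<phi> ` verts L' \<subseteq> verts G" and E: "(`) \<phi> ` edges L' \<subseteq> edges G"
    have injF: "inj_on \<phi> (verts F)" and injL: "inj_on \<phi> (verts L)"
      using inj inj_on_subset by (auto simp: vL')
    have "\<phi> ` R \<in> edges (perc_closure H G)"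
      using inf G injL V E unfolding infects_def vL' eL' by blast
    moreover have "\<phi> ` x \<in> edges (perc_closure H G)" if "x \<in> edges F - {R, R'}" for x
      using that E perc_closure_extensive[of G H] unfolding eL' by blast
    ultimately have sub: "(`) \<phi> ` edges F - {\<phi> ` R'} \<subseteq> edges (perc_closure H G)" by blast
    define K where "K = (\<phi> ` verts F, (`) \<phi> ` edges F)"
    have iso': "isomorphic H K"
    proof -
      have "bij_betw (\<phi> \<circ> f) (verts H) (\<phi> ` verts F)"
        using f injF by (auto simp: bij_betw_def F_def comp_inj_on image_comp)
      moreover have "edges K = (\<lambda>e. (\<phi> \<circ> f) ` e) ` edges H"
        by (simp add: K_def F_def image_image image_comp)
      ultimately show ?thesis unfolding isomorphic_def K_def by auto
    qed
    have "simple_graph K"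
      using sub_sparse_isomorphic[OF H iso'] by (simp add: sub_sparse_def)
    then show "\<phi> ` R' \<in> edges (perc_closure H G)"
      by (rule perc_closure_closed[OF iso'])
        (use V RF sub in \<open>auto simp: K_def vL'\<close>)
  qed
  ultimately show ?case using sL' by blast
qed

section \<open>Random graphs, sprinkling and the second moment method\<close>

lemma random_graph_simple:
  assumes "G \<in> set_pmf (random_graph n p)"
  shows "simple_graph G" "verts G = {..<n}"
  using assms by (auto simp: random_graph_def simple_graph_def)

lemma prob_random_graph_contains:
  assumes p: "0 \<le> p" "p \<le> 1" and D: "D \<subseteq> pairs {..<n}"
  shows "measure_pmf.prob (random_graph n p) {G. D \<subseteq> edges G} = p ^ card D"
proof -
  have fin: "finite (pairs {..<n})" by (simp add: finite_pairs)
  have "measure_pmf.prob (random_graph n p) {G. D \<subseteq> edges G}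
     = measure_pmf.prob (Pi_pmf (pairs {..<n}) False (\<lambda>_. bernoulli_pmf p))
         (Pi (pairs {..<n}) (\<lambda>e. if e \<in> D then {True} else UNIV))"
    unfolding random_graph_def measure_map_pmf
    by (rule arg_cong[where f = "measure_pmf.prob _"]) (use D in \<open>auto simp: Pi_def split: if_splits\<close>)
  also have "\<dots> = (\<Prod>e\<in>pairs {..<n}. measure_pmf.prob (bernoulli_pmf p) (if e \<in> D then {True} else UNIV))"
    using fin by (rule measure_Pi_pmf_Pi)
  also have "\<dots> = (\<Prod>e\<in>pairs {..<n}. if e \<in> D then p else 1)"
    by (rule prod.cong) (use p in \<open>auto simp: measure_pmf_single\<close>)
  also have "\<dots> = p ^ card D"
    using fin D by (simp add: prod.If_cases Int_absorb1)
  finally show ?thesis .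
qed

text \<open>
  The disjunction of two independent coin tosses fails exactly if both tosses fail.
\<close>
lemma bernoulli_or:
  assumes "0 \<le> p" "p \<le> 1" "0 \<le> q" "q \<le> 1"
  shows "bernoulli_pmf (1 - (1 - p) * (1 - q)) =
    bernoulli_pmf p \<bind> (\<lambda>a. bernoulli_pmf q \<bind> (\<lambda>b. return_pmf (a \<or> b)))"
proof (rule pmf_eqI)
  fix x
  have "0 \<le> (1 - p) * (1 - q)" "(1 - p) * (1 - q) \<le> 1"
    using assms by (auto intro: mult_le_one)
  then show "pmf (bernoulli_pmf (1 - (1 - p) * (1 - q))) x =
     pmf (bernoulli_pmf p \<bind> (\<lambda>a. bernoulli_pmf q \<bind> (\<lambda>b. return_pmf (a \<or> b)))) x"
    using assms by (cases x) (auto simp: pmf_bind indicator_def algebra_simps)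
qed

lemma random_graph_union:
  assumes "0 \<le> p" "p \<le> 1" "0 \<le> q" "q \<le> 1"
  shows "random_graph n (1 - (1 - p) * (1 - q)) =
    map_pmf (\<lambda>(G, G'). ({..<n}, edges G \<union> edges G')) (pair_pmf (random_graph n p) (random_graph n q))"
proof -
  let ?A = "pairs {..<n}" and ?P = "\<lambda>p. Pi_pmf (pairs {..<n}) False (\<lambda>_. bernoulli_pmf p)"
  have fin: "finite ?A" by (simp add: finite_pairs)
  have "?P (1 - (1 - p) * (1 - q)) =
      ?P p \<bind> (\<lambda>X. ?P q \<bind> (\<lambda>Y. return_pmf (\<lambda>e. if e \<in> ?A then X e \<or> Y e else False)))"
    unfolding bernoulli_or[OF assms] using fin
    by (simp add: Pi_pmf_bind[where d' = False])
  then show ?thesis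
    unfolding random_graph_def
    by (simp add: map_pmf_def pair_pmf_def bind_assoc_pmf bind_return_pmf)
       (intro bind_pmf_cong refl arg_cong[where f = return_pmf], auto)
qed

text \<open>
  A decreasing property of the union of two graphs passes to both of them, and these are
  independent.
\<close>
lemma prob_decreasing_union:
  assumes pq: "0 \<le> p" "p \<le> 1" "0 \<le> q" "q \<le> 1"
    and D: "\<And>G G'. \<lbrakk>simple_graph G; simple_graph G'; verts G = {..<n}; verts G' = {..<n};
       edges G \<subseteq> edges G'; D G'\<rbrakk> \<Longrightarrow> D G"
  shows "measure_pmf.prob (random_graph n (1 - (1 - p) * (1 - q))) {G. D G}
    \<le> measure_pmf.prob (random_graph n p) {G. D G} * measure_pmf.prob (random_graph n q) {G. D G}"
proof -
  let ?S = "{G :: nat graph. verts G = {..<n} \<and> edges G \<subseteq> pairs {..<n}}"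
  have S: "finite ?S"
  proof -
    have "?S \<subseteq> {{..<n}} \<times> Pow (pairs {..<n})" by auto
    then show ?thesis by (rule finite_subset) (simp add: finite_pairs)
  qed
  have supp: "set_pmf (random_graph n r) \<subseteq> ?S" for r
    by (auto simp: random_graph_def)
  have "measure_pmf.prob (random_graph n (1 - (1 - p) * (1 - q))) {G. D G}
     = measure_pmf.prob (pair_pmf (random_graph n p) (random_graph n q))
         {(G, G'). D ({..<n}, edges G \<union> edges G')}"
    unfolding random_graph_union[OF pq] measure_map_pmf
    by (rule arg_cong[where f = "measure_pmf.prob _"]) auto
  also have "\<dots> \<le> measure_pmf.prob (pair_pmf (random_graph n p) (random_graph n q))
         (({G. D G} \<inter> ?S) \<times> ({G. D G} \<inter> ?S))"
  proof (rule measure_pmf.finite_measure_mono_AE)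
    show "AE x in measure_pmf (pair_pmf (random_graph n p) (random_graph n q)).
        x \<in> {(G, G'). D ({..<n}, edges G \<union> edges G')} \<longrightarrow>
        x \<in> ({G. D G} \<inter> ?S) \<times> ({G. D G} \<inter> ?S)"
    proof (rule AE_pmfI, rule impI)
      fix x assume x: "x \<in> set_pmf (pair_pmf (random_graph n p) (random_graph n q))"
        and Dx: "x \<in> {(G, G'). D ({..<n}, edges G \<union> edges G')}"
      obtain G G' where xG: "x = (G, G')" by (cases x)
      have G: "G \<in> ?S" "G' \<in> ?S" using x xG supp by auto
      have "simple_graph ({..<n}, edges G \<union> edges G')" "simple_graph G" "simple_graph G'"
        using G by (auto simp: simple_graph_def)
      then have "D G" "D G'"
        using G Dx xG D[of G "({..<n}, edges G \<union> edges G')"] D[of G' "({..<n}, edges G \<union> edges G')"]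
        by auto
      then show "x \<in> ({G. D G} \<inter> ?S) \<times> ({G. D G} \<inter> ?S)" using xG G by simp
    qed
  qed simp
  also have "\<dots> = measure_pmf.prob (random_graph n p) ({G. D G} \<inter> ?S) *
      measure_pmf.prob (random_graph n q) ({G. D G} \<inter> ?S)"
    using S by (intro measure_pmf_prob_product) (auto intro: countable_finite)
  also have "\<dots> \<le> measure_pmf.prob (random_graph n p) {G. D G} * measure_pmf.prob (random_graph n q) {G. D G}"
    by (intro mult_mono measure_pmf.finite_measure_mono) auto
  finally show ?thesis .
qed

lemma prob_decreasing_sprinkle:
  assumes q: "0 \<le> q" "q \<le> 1"
    and D: "\<And>G G'. \<lbrakk>simple_graph G; simple_graph G'; verts G = {..<n}; verts G' = {..<n};
       edges G \<subseteq> edges G'; D G'\<rbrakk> \<Longrightarrow> D G"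
  shows "measure_pmf.prob (random_graph n (1 - (1 - q) ^ k)) {G. D G}
    \<le> measure_pmf.prob (random_graph n q) {G. D G} ^ k"
proof (induction k)
  case 0
  then show ?case by simp
next
  case (Suc k)
  have r: "0 \<le> 1 - (1 - q) ^ k" "1 - (1 - q) ^ k \<le> 1"
    using q by (auto simp: power_le_one)
  have "measure_pmf.prob (random_graph n (1 - (1 - q) ^ Suc k)) {G. D G}
      = measure_pmf.prob (random_graph n (1 - (1 - q) * (1 - (1 - (1 - q) ^ k)))) {G. D G}" by simp
  also have "\<dots> \<le> measure_pmf.prob (random_graph n q) {G. D G} *
      measure_pmf.prob (random_graph n (1 - (1 - q) ^ k)) {G. D G}"
    by (rule prob_decreasing_union[OF q r D])
  also have "\<dots> \<le> measure_pmf.prob (random_graph n q) {G. D G} *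
      measure_pmf.prob (random_graph n q) {G. D G} ^ k"
    by (rule mult_left_mono[OF Suc.IH]) simp
  finally show ?case by simp
qed

text \<open>
  Let \<open>X\<close> be the number of events that occur and \<open>\<mu>\<close> its expectation. The indicator of the union
  is at least \<open>2 t X - t\<^sup>2 X\<^sup>2\<close> for every \<open>t\<close>, because \<open>(t X - 1)\<^sup>2 \<ge> 0\<close> and both sides
  vanish if \<open>X = 0\<close>. Take expectations and put \<open>t = \<mu> / S\<close>.
\<close>
lemma prob_Union_ge_second_moment:
  fixes M :: "'a pmf" and A :: "'i \<Rightarrow> 'a set"
  assumes I: "finite I" and S: "S > 0"
    and S2: "(\<Sum>i\<in>I. \<Sum>j\<in>I. measure_pmf.prob M (A i \<inter> A j)) \<le> S"
  shows "(\<Sum>i\<in>I. measure_pmf.prob M (A i))\<^sup>2 / S \<le> measure_pmf.prob M (\<Union>i\<in>I. A i)"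
proof -
  define X where "X = (\<lambda>\<omega>. \<Sum>i\<in>I. indicat_real (A i) \<omega>)"
  define \<mu> where "\<mu> = (\<Sum>i\<in>I. measure_pmf.prob M (A i))"
  define S' where "S' = (\<Sum>i\<in>I. \<Sum>j\<in>I. measure_pmf.prob M (A i \<inter> A j))"
  define t where "t = \<mu> / S"
  have X2: "(X \<omega>)\<^sup>2 = (\<Sum>i\<in>I. \<Sum>j\<in>I. indicat_real (A i \<inter> A j) \<omega>)" for \<omega>
    by (simp add: X_def power2_eq_square sum_product indicator_inter_arith)
  have int: "integrable (measure_pmf M) (indicat_real B)" for B
    by (rule measure_pmf.integrable_const_bound[where B = 1]) (auto simp: indicator_def)
  have EX: "measure_pmf.expectation M X = \<mu>"
    unfolding X_def \<mu>_def using int by simp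
  have EX2: "measure_pmf.expectation M (\<lambda>\<omega>. (X \<omega>)\<^sup>2) = S'"
    unfolding X2 S'_def using int by simp
  have iX: "integrable (measure_pmf M) X" "integrable (measure_pmf M) (\<lambda>\<omega>. (X \<omega>)\<^sup>2)"
    unfolding X2 unfolding X_def using int by auto
  have pt: "2 * t * X \<omega> - t\<^sup>2 * (X \<omega>)\<^sup>2 \<le> indicat_real (\<Union>i\<in>I. A i) \<omega>" for \<omega>
  proof (cases "\<omega> \<in> (\<Union>i\<in>I. A i)")
    case True
    have "0 \<le> (t * X \<omega> - 1)\<^sup>2" by simp
    then have "2 * t * X \<omega> - t\<^sup>2 * (X \<omega>)\<^sup>2 \<le> 1" by (simp add: power2_eq_square algebra_simps)
    then show ?thesis using True by simp
  next
    case False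
    then have "X \<omega> = 0" by (auto simp: X_def indicator_def)
    then show ?thesis using False by simp
  qed
  have "2 * t * \<mu> - t\<^sup>2 * S' = measure_pmf.expectation M (\<lambda>\<omega>. 2 * t * X \<omega> - t\<^sup>2 * (X \<omega>)\<^sup>2)"
    using iX by (simp add: EX EX2)
  also have "\<dots> \<le> measure_pmf.expectation M (indicat_real (\<Union>i\<in>I. A i))"
    using iX int pt by (intro integral_mono) auto
  also have "\<dots> = measure_pmf.prob M (\<Union>i\<in>I. A i)" by simp
  finally have 1: "2 * t * \<mu> - t\<^sup>2 * S' \<le> measure_pmf.prob M (\<Union>i\<in>I. A i)" .
  have "t\<^sup>2 * S' \<le> t\<^sup>2 * S" using S2 by (intro mult_left_mono) (auto simp: S'_def)
  also have "t\<^sup>2 * S = \<mu>\<^sup>2 / S" using S by (simp add: t_def power2_eq_square)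
  finally have "2 * t * \<mu> - \<mu>\<^sup>2 / S \<le> measure_pmf.prob M (\<Union>i\<in>I. A i)" using 1 by linarith
  moreover have "2 * t * \<mu> = 2 * (\<mu>\<^sup>2 / S)" by (simp add: t_def power2_eq_square)
  ultimately show ?thesis by (simp add: \<mu>_def)
qed

text \<open>
  Second moment method for the embeddings of \<open>L\<close> that map \<open>R\<close> to \<open>r\<close> in a fixed way. Two
  embeddings \<open>f\<close> and \<open>h\<close> can share only edges inside the set \<open>W\<close> of vertices that \<open>h\<close> maps into the
  image of \<open>f\<close>, and by \<open>many\<close> the gain in probability from sharing them is at most
  \<open>n ^ (card W - 2)\<close>. This power is a product over the vertices \<open>v\<close> outside the root, with a factor
  \<open>n\<close> if \<open>h v\<close> lies in the image of \<open>f\<close> and a factor 1 otherwise. Therefore its sum over all \<open>h\<close>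
  factorises, and each factor is at most \<open>card (verts L) * n\<close>.
\<close>
lemma prob_rooted_copy_ge:
  fixes L :: "nat graph" and n :: nat
  defines "m \<equiv> card (verts L)"
  assumes L: "simple_graph L" and R: "R \<in> pairs (verts L)" and xy: "r \<in> pairs {..<n}"
    and q: "0 < q" "q \<le> 1" and n: "2 * m \<le> n"
    and many: "\<And>W. \<lbrakk>R \<subseteq> W; W \<subseteq> verts L\<rbrakk>
       \<Longrightarrow> 1 \<le> q ^ card (edges L \<inter> pairs W) * real n ^ (card W - 2)"
  shows "(1 / (2 * real m)) ^ (m - 2) \<le> measure_pmf.prob (random_graph n q)
     {G. \<exists>\<phi>. inj_on \<phi> (verts L) \<and> \<phi> ` verts L \<subseteq> {..<n} \<and> \<phi> ` R = r \<and>
        (`) \<phi> ` edges L \<subseteq> edges G}"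
proof -
  note fin = simple_graphD[OF L]
  define Q where "Q = verts L - R"
  define T where "T = {..<n} - r"
  \<comment> \<open>the free part of an embedding; \<open>ext\<close> below adds a fixed bijection \<open>g\<close> from \<open>R\<close> to \<open>r\<close>\<close>
  define \<Psi> where "\<Psi> = {f \<in> Q \<rightarrow>\<^sub>E T. inj_on f Q}"
  define E where "E = card (edges L)"
  have RV: "R \<subseteq> verts L" "card R = 2" using R by (auto simp: pairs_def)
  have rV: "r \<subseteq> {..<n}" "card r = 2" using xy by (auto simp: pairs_def)
  have finR: "finite R" using RV fin finite_subset by blast
  have finr: "finite r" using rV finite_subset by blast
  have finQ: "finite Q" using fin by (simp add: Q_def)
  have VQ: "verts L = Q \<union> R" using RV by (auto simp: Q_def)
  have cQ: "card Q = m - 2" using finR RV by (simp add: Q_def m_def card_Diff_subset)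
  have m2: "2 \<le> m" using card_mono[OF fin(1) RV(1)] RV by (simp add: m_def)
  have cT: "card T = n - 2" using finr rV by (simp add: T_def card_Diff_subset)
  have fin\<Psi>: "finite \<Psi>" unfolding \<Psi>_def using finQ by (simp add: T_def finite_PiE)
  obtain g where g: "bij_betw g R r" using finite_same_card_bij[OF finR finr] RV rV by auto
  define ext where "ext = (\<lambda>f v. if v \<in> Q then f v else g v :: nat)"
  have ext_R: "ext f ` R = r" for f using g by (auto simp: ext_def Q_def bij_betw_def)
  have ext_Q: "ext f ` Q = f ` Q" for f by (auto simp: ext_def)
  have fQ: "f ` Q \<subseteq> T" if "f \<in> \<Psi>" for f using that by (auto simp: \<Psi>_def)
  have ext_V: "ext f ` verts L \<subseteq> {..<n}" if "f \<in> \<Psi>" for f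
    unfolding VQ image_Un ext_R ext_Q using fQ[OF that] rV by (auto simp: T_def)
  have ext_inj: "inj_on (ext f) (verts L)" if f: "f \<in> \<Psi>" for f
    unfolding VQ
  proof (rule inj_on_Un[THEN iffD2], intro conjI)
    have "inj_on f Q" using f by (simp add: \<Psi>_def)
    then show "inj_on (ext f) Q" by (simp add: ext_def inj_on_def)
    have "inj_on g R" using g by (simp add: bij_betw_def)
    then show "inj_on (ext f) R" by (auto simp: ext_def inj_on_def Q_def)
    show "ext f ` (Q - R) \<inter> ext f ` (R - Q) = {}"
    proof -
      have "ext f ` (Q - R) \<subseteq> T" using fQ[OF f] ext_Q[of f] by blast
      moreover have "ext f ` (R - Q) \<subseteq> r" using ext_R[of f] by blast
      ultimately show ?thesis unfolding T_def by blast
    qed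
  qed
  have ext_edges: "(`) (ext f) ` edges L \<subseteq> pairs {..<n}" if f: "f \<in> \<Psi>" for f
  proof -
    have "(`) (ext f) ` edges L \<subseteq> pairs (ext f ` verts L)"
      using fin(3) image_mem_pairs[OF ext_inj[OF f]] by (auto intro!: image_mem_pairs[OF ext_inj[OF f]])
    then show ?thesis using pairs_mono[OF ext_V[OF f]] by blast
  qed
  have ext_inj_edges: "inj_on ((`) (ext f)) (edges L)" if f: "f \<in> \<Psi>" for f
    using ext_inj[OF f] fin(3) by (rule inj_on_image_edges)
  define A where "A = (\<lambda>f. {G :: nat graph. (`) (ext f) ` edges L \<subseteq> edges G})"
  have PA: "measure_pmf.prob (random_graph n q) (A f) = q ^ E" if f: "f \<in> \<Psi>" for f
    using prob_random_graph_contains[OF _ q(2) ext_edges[OF f]] q ext_inj_edges[OF f]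
    by (simp add: A_def E_def card_image)
  \<comment> \<open>summing the product on the right over all \<open>h\<close> is easy; it is \<open>n ^ (card W - 2)\<close> for the overlap \<open>W\<close>\<close>
  have PAA: "measure_pmf.prob (random_graph n q) (A f \<inter> A h)
      \<le> q ^ (2 * E) * (\<Prod>v\<in>Q. if h v \<in> f ` Q then real n else 1)" if f: "f \<in> \<Psi>" and h: "h \<in> \<Psi>" for f h
  proof -
    let ?f = "(`) (ext f) ` edges L" and ?h = "(`) (ext h) ` edges L"
    define W where "W = R \<union> {v \<in> Q. h v \<in> f ` Q}"
    define w where "w = card (edges L \<inter> pairs W)"
    have WV: "W \<subseteq> verts L" unfolding W_def VQ by blast
    have cW: "card W = 2 + card {v \<in> Q. h v \<in> f ` Q}"
      unfolding W_def using finR finQ RV by (subst card_Un_disjoint) (auto simp: Q_def)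
    have wE: "w \<le> E" unfolding w_def E_def using fin(2) by (intro card_mono) auto
    have "?f \<inter> ?h \<subseteq> (`) (ext h) ` (edges L \<inter> pairs W)"
    proof
      fix d assume "d \<in> ?f \<inter> ?h"
      then obtain a b where a: "a \<in> edges L" "d = ext f ` a" and b: "b \<in> edges L" "d = ext h ` b" by blast
      have aV: "a \<subseteq> verts L" and bV: "b \<subseteq> verts L" "card b = 2"
        using a b fin(3) by (auto simp: pairs_def)
      have "b \<subseteq> W"
      proof
        fix v assume v: "v \<in> b"
        show "v \<in> W"
        proof (cases "v \<in> R")
          case False
          then have vQ: "v \<in> Q" using v bV VQ by blast
          then have "h v \<in> d" using v b by (auto simp: ext_def)
          then have "h v \<in> r \<union> f ` Q" using a aV ext_R[of f] ext_Q[of f] unfolding VQ by blast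
          moreover have "h v \<notin> r" using fQ[OF h] vQ by (auto simp: T_def)
          ultimately show ?thesis using vQ by (simp add: W_def)
        qed (simp add: W_def)
      qed
      then show "d \<in> (`) (ext h) ` (edges L \<inter> pairs W)" using b bV by (auto simp: pairs_def)
    qed
    then have "card (?f \<inter> ?h) \<le> card ((`) (ext h) ` (edges L \<inter> pairs W))"
      using fin(2) by (intro card_mono) auto
    also have "\<dots> \<le> w" unfolding w_def using fin(2) by (intro card_image_le) auto
    finally have cap: "card (?f \<inter> ?h) \<le> w" .
    have "card ?f = E" "card ?h = E"
      using ext_inj_edges f h by (auto simp: card_image E_def)
    then have cup: "2 * E - w \<le> card (?f \<union> ?h)"
      using card_Un_Int[of ?f ?h] fin(2) cap by simp
    have "A f \<inter> A h = {G. ?f \<union> ?h \<subseteq> edges G}" by (auto simp: A_def)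
    then have "measure_pmf.prob (random_graph n q) (A f \<inter> A h) = q ^ card (?f \<union> ?h)"
      using prob_random_graph_contains[of q "?f \<union> ?h" n] q ext_edges f h by simp
    also have "\<dots> \<le> q ^ (2 * E - w)" using cup q by (intro power_decreasing) auto
    also have "\<dots> \<le> q ^ (2 * E - w) * (q ^ w * real n ^ (card W - 2))"
      using many[OF _ WV] q by (simp add: W_def w_def mult_le_cancel_left1)
    also have "\<dots> = q ^ (2 * E) * real n ^ card {v \<in> Q. h v \<in> f ` Q}"
      using wE cW by (simp add: power_add[symmetric] mult.assoc[symmetric])
    also have "real n ^ card {v \<in> Q. h v \<in> f ` Q} = (\<Prod>v\<in>Q. if h v \<in> f ` Q then real n else 1)"
      using finQ by (simp add: prod.If_cases Int_def)
    finally show ?thesis .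
  qed
  define S where "S = real (card \<Psi>) * (q ^ (2 * E) * (real m * real n) ^ (m - 2))"
  have n0: "0 < n" using n m2 by linarith
  have card\<Psi>: "(real n / 2) ^ (m - 2) \<le> real (card \<Psi>)"
  proof -
    have "card \<Psi> = (\<Prod>i = 0..<m - 2. n - 2 - i)"
      unfolding \<Psi>_def using card_inj_on_subset_funcset[OF finQ, of T Q] cT cQ by (simp add: T_def)
    then have "real (card \<Psi>) = (\<Prod>i = 0..<m - 2. real (n - 2 - i))" by simp
    moreover have "(\<Prod>i = 0..<m - 2. real n / 2) \<le> (\<Prod>i = 0..<m - 2. real (n - 2 - i))"
      by (intro prod_mono) (use n in auto)
    ultimately show ?thesis by simp
  qed
  have \<Psi>0: "0 < real (card \<Psi>)"
    by (rule less_le_trans[OF _ card\<Psi>]) (use n0 in simp)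
  have S0: "0 < S" unfolding S_def using \<Psi>0 q n0 m2 by simp
  have "(\<Sum>f\<in>\<Psi>. \<Sum>h\<in>\<Psi>. measure_pmf.prob (random_graph n q) (A f \<inter> A h)) \<le> S"
  proof -
    have "(\<Sum>h\<in>\<Psi>. measure_pmf.prob (random_graph n q) (A f \<inter> A h))
        \<le> q ^ (2 * E) * (real m * real n) ^ (m - 2)" if f: "f \<in> \<Psi>" for f
    proof -
      have "(\<Sum>h\<in>\<Psi>. measure_pmf.prob (random_graph n q) (A f \<inter> A h))
         \<le> (\<Sum>h\<in>\<Psi>. q ^ (2 * E) * (\<Prod>v\<in>Q. if h v \<in> f ` Q then real n else 1))"
        using PAA[OF f] by (intro sum_mono)
      also have "\<dots> \<le> (\<Sum>h\<in>Q \<rightarrow>\<^sub>E {..<n}. q ^ (2 * E) * (\<Prod>v\<in>Q. if h v \<in> f ` Q then real n else 1))"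
      proof (rule sum_mono2)
        show "\<Psi> \<subseteq> Q \<rightarrow>\<^sub>E {..<n}" unfolding \<Psi>_def T_def by (auto simp: PiE_def Pi_def)
      qed (use finQ q in \<open>auto intro!: finite_PiE mult_nonneg_nonneg prod_nonneg\<close>)
      also have "\<dots> = q ^ (2 * E) * (\<Prod>v\<in>Q. \<Sum>j<n. if j \<in> f ` Q then real n else 1)"
        by (subst prod_sum_PiE) (use finQ in \<open>simp_all add: sum_distrib_left\<close>)
      also have "\<dots> \<le> q ^ (2 * E) * (\<Prod>v\<in>Q. real m * real n)"
      proof (intro mult_left_mono prod_mono conjI)
        have "(\<Sum>j<n. if j \<in> f ` Q then real n else 1) \<le> (\<Sum>j<n. (if j \<in> f ` Q then real n else 0) + 1)"
          by (intro sum_mono) auto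
        also have "\<dots> = real (card ({..<n} \<inter> f ` Q)) * real n + real n"
          by (simp add: sum.distrib sum.If_cases Int_def)
        also have "\<dots> \<le> real (m - 2) * real n + real n"
        proof -
          have "card ({..<n} \<inter> f ` Q) \<le> card (f ` Q)" using finQ by (intro card_mono) auto
          also have "\<dots> \<le> m - 2" using card_image_le[OF finQ, of f] cQ by simp
          finally show ?thesis by (simp add: mult_right_mono)
        qed
        also have "\<dots> \<le> real m * real n" using m2 by (simp add: of_nat_diff algebra_simps)
        finally show "(\<Sum>j<n. if j \<in> f ` Q then real n else 1) \<le> real m * real n" .
      qed (use q in \<open>auto intro: sum_nonneg\<close>)
      also have "\<dots> = q ^ (2 * E) * (real m * real n) ^ (m - 2)" using cQ by simp
      finally show ?thesis .
    qed
    then have "(\<Sum>f\<in>\<Psi>. \<Sum>h\<in>\<Psi>. measure_pmf.prob (random_graph n q) (A f \<inter> A h))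
        \<le> (\<Sum>f\<in>\<Psi>. q ^ (2 * E) * (real m * real n) ^ (m - 2))" by (rule sum_mono)
    then show ?thesis by (simp add: S_def)
  qed
  from prob_Union_ge_second_moment[OF fin\<Psi> S0 this]
  have "(\<Sum>f\<in>\<Psi>. measure_pmf.prob (random_graph n q) (A f))\<^sup>2 / S
     \<le> measure_pmf.prob (random_graph n q) (\<Union>f\<in>\<Psi>. A f)" .
  moreover have "(\<Sum>f\<in>\<Psi>. measure_pmf.prob (random_graph n q) (A f)) = real (card \<Psi>) * q ^ E"
    using PA by simp
  moreover have "(real (card \<Psi>) * q ^ E)\<^sup>2 / S = real (card \<Psi>) / (real m * real n) ^ (m - 2)"
  proof -
    have "q ^ (2 * E) = q ^ E * q ^ E" by (simp add: mult_2 power_add)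
    then show ?thesis
      using \<Psi>0 q n0 m2 unfolding S_def by (simp add: power2_eq_square field_simps)
  qed
  moreover have "(1 / (2 * real m)) ^ (m - 2) \<le> real (card \<Psi>) / (real m * real n) ^ (m - 2)"
  proof -
    have "(1 / (2 * real m)) ^ (m - 2) = (real n / 2) ^ (m - 2) / (real m * real n) ^ (m - 2)"
    proof -
      have "1 / (2 * real m) = (real n / 2) / (real m * real n)" using n0 m2 by simp
      then show ?thesis by (simp only: power_divide)
    qed
    then show ?thesis using card\<Psi> n0 m2 by (simp add: divide_right_mono)
  qed
  moreover have "measure_pmf.prob (random_graph n q) (\<Union>f\<in>\<Psi>. A f)
     \<le> measure_pmf.prob (random_graph n q)
     {G. \<exists>\<phi>. inj_on \<phi> (verts L) \<and> \<phi> ` verts L \<subseteq> {..<n} \<and> \<phi> ` R = r \<and>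
        (`) \<phi> ` edges L \<subseteq> edges G}"
  proof (rule measure_pmf.finite_measure_mono, rule subsetI)
    fix G assume "G \<in> (\<Union>f\<in>\<Psi>. A f)"
    then obtain f where f: "f \<in> \<Psi>" "(`) (ext f) ` edges L \<subseteq> edges G" by (auto simp: A_def)
    show "G \<in> {G. \<exists>\<phi>. inj_on \<phi> (verts L) \<and> \<phi> ` verts L \<subseteq> {..<n} \<and> \<phi> ` R = r \<and>
        (`) \<phi> ` edges L \<subseteq> edges G}"
      using ext_inj[OF f(1)] ext_V[OF f(1)] ext_R[of f] f(2)
      by (intro CollectI exI[of _ "ext f"] conjI)
  qed simp
  ultimately show ?thesis by (metis (no_types, lifting) order_trans)
qed

section \<open>Percolation above the threshold\<close>

text \<open>
  The exponent of \<open>n\<close> on the right is at least 0: when the additional edge of \<open>rooted_sparse\<close>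
  occurs, it costs at most \<open>1 / l \<le> 1\<close>, while the at least \<open>k\<close> vertices outside the root gain
  \<open>l * \<epsilon> * k \<ge> 1\<close>.
\<close>
lemma ladder_many_copies:
  assumes L: "simple_graph L" and R: "R \<in> pairs (verts L)" and sp: "rooted_sparse l k L R"
    and l: "l \<ge> 1" and \<epsilon>: "\<epsilon> > 0" and k: "1 \<le> real k * \<epsilon>" and \<epsilon>l: "\<epsilon> \<le> 1 / l" and n: "n \<ge> 1"
    and q: "q = real n powr (- 1 / l + \<epsilon>)"
    and W: "R \<subseteq> W" "W \<subseteq> verts L"
  shows "1 \<le> q ^ card (edges L \<inter> pairs W) * real n ^ (card W - 2)"
proof -
  have finW: "finite W" using W simple_graphD[OF L] finite_subset by blast
  have finR: "finite R" "card R = 2" using W finW R finite_subset by (auto simp: pairs_def)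
  define j where "j = card (W - R)"
  have cW: "card W = j + 2"
    using card_Diff_subset[OF finR(1) W(1)] card_mono[OF finW W(1)] finR by (simp add: j_def)
  define x where "x = card (edges L \<inter> pairs W)"
  have q0: "q > 0" using n q by simp
  have q1: "q ^ x * real n ^ (card W - 2) = real n powr (real j - (1 / l - \<epsilon>) * real x)"
    using n q0 unfolding q cW
    by (simp add: powr_realpow[symmetric] powr_powr powr_add[symmetric] algebra_simps)
  have *: "(1 / l - \<epsilon>) * real x \<le> real j"
  proof -
    have "real x \<le> l * real j \<or> (k + 2 \<le> card W \<and> real x \<le> l * real j + 1)"
      using sp[unfolded rooted_sparse_def, rule_format, OF W(2)] by (auto simp: x_def j_def)
    then show ?thesis
    proof
      assume "real x \<le> l * real j"
      then have "(1 / l - \<epsilon>) * real x \<le> (1 / l) * (l * real j)"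
        using l \<epsilon> \<epsilon>l by (intro mult_mono) auto
      then show ?thesis using l by simp
    next
      assume a: "k + 2 \<le> card W \<and> real x \<le> l * real j + 1"
      then have "real k \<le> real j" using cW by simp
      then have "1 \<le> real j * \<epsilon>" using k \<epsilon> mult_right_mono[of "real k" "real j" \<epsilon>] by linarith
      also have "real j * \<epsilon> \<le> l * (real j * \<epsilon>)" using l \<epsilon> mult_right_mono[of 1 l "real j * \<epsilon>"] by simp
      finally have "1 \<le> l * \<epsilon> * real j" by (simp add: mult_ac)
      moreover have "1 / l \<le> 1" using l by simp
      moreover have "(1 / l - \<epsilon>) * real x \<le> (1 / l - \<epsilon>) * (l * real j + 1)"
        using a \<epsilon>l by (intro mult_left_mono) auto
      moreover have "(1 / l - \<epsilon>) * (l * real j + 1) = real j + 1 / l - l * \<epsilon> * real j - \<epsilon>"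
        using l by (simp add: algebra_simps)
      ultimately show ?thesis using \<epsilon> by linarith
    qed
  qed
  show ?thesis unfolding x_def[symmetric] q1
    using n * by (intro ge_one_powr_ge_zero) auto
qed

lemma prob_edge_in_closure_ge:
  fixes H :: "'a graph"
  assumes H: "sub_sparse l H" and l: "l \<ge> 1" and v: "card (verts H) \<ge> 3"
    and \<epsilon>: "0 < \<epsilon>" "\<epsilon> \<le> 1 / l"
  shows "\<exists>c>0. c \<le> 1 \<and> (\<forall>\<^sub>F n in sequentially. \<forall>r\<in>pairs {..<n}.
     c \<le> measure_pmf.prob (random_graph n (real n powr (- 1 / l + \<epsilon>)))
          {G. r \<in> edges (perc_closure H G)})"
proof -
  have "real (card (edges H)) = l * (real (card (verts H)) - 2) + 2"
    using H by (simp add: sub_sparse_def)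
  moreover have "0 \<le> l * (real (card (verts H)) - 2)" using l v by simp
  ultimately have "2 \<le> card (edges H)" by linarith
  then obtain d e where de: "d \<in> edges H" "e \<in> edges H" "d \<noteq> e"
  proof -
    obtain T where T: "T \<subseteq> edges H" "card T = 2"
      using obtain_subset_with_card_n[OF \<open>2 \<le> card (edges H)\<close>] by metis
    then obtain d e where "T = {d, e}" "d \<noteq> e" by (auto simp: card_2_iff)
    then show ?thesis using T that by auto
  qed
  obtain k :: nat where k: "1 / \<epsilon> \<le> real k" using real_arch_simple by blast
  then have k': "1 \<le> real k * \<epsilon>" using \<epsilon> by (simp add: divide_le_eq)
  obtain L R where L: "simple_graph L" "R \<in> pairs (verts L)" "rooted_sparse l k L R" "infects H L R"
    using ladder_exists[OF H l de] by blast
  define m where "m = card (verts L)"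
  define c where "c = (1 / (2 * real m)) ^ (m - 2)"
  have "card R \<le> m"
    unfolding m_def by (rule card_mono[OF simple_graphD(1)[OF L(1)]]) (use L(2) in \<open>simp add: pairs_def\<close>)
  then have m2: "2 \<le> m" using L(2) by (simp add: pairs_def)
  have c: "0 < c" "c \<le> 1" using m2 by (auto simp: c_def intro!: power_le_one)
  have "c \<le> measure_pmf.prob (random_graph n (real n powr (- 1 / l + \<epsilon>)))
          {G. r \<in> edges (perc_closure H G)}" if n: "2 * m \<le> n" and r: "r \<in> pairs {..<n}" for n r
  proof -
    let ?q = "real n powr (- 1 / l + \<epsilon>)"
    have n1: "1 \<le> n" using n m2 by linarith
    have q: "0 < ?q" "?q \<le> 1"
      using n1 \<epsilon> powr_mono[of "- 1 / l + \<epsilon>" 0 "real n"] by auto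
    have "c \<le> measure_pmf.prob (random_graph n ?q)
     {G. \<exists>\<phi>. inj_on \<phi> (verts L) \<and> \<phi> ` verts L \<subseteq> {..<n} \<and> \<phi> ` R = r \<and>
        (`) \<phi> ` edges L \<subseteq> edges G}"
      unfolding c_def m_def
      by (rule prob_rooted_copy_ge[OF L(1,2) r q])
        (use n ladder_many_copies[OF L(1-3) l \<epsilon>(1) k' \<epsilon>(2) n1 refl] in \<open>auto simp: m_def\<close>)
    also have "\<dots> \<le> measure_pmf.prob (random_graph n ?q) {G. r \<in> edges (perc_closure H G)}"
    proof (rule measure_pmf.finite_measure_mono_AE[OF AE_pmfI])
      fix G assume G: "G \<in> set_pmf (random_graph n ?q)"
      show "G \<in> {G. \<exists>\<phi>. inj_on \<phi> (verts L) \<and> \<phi> ` verts L \<subseteq> {..<n} \<and> \<phi> ` R = r \<and>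
        (`) \<phi> ` edges L \<subseteq> edges G} \<longrightarrow> G \<in> {G. r \<in> edges (perc_closure H G)}"
        using L(4)[unfolded infects_def, rule_format, of G] random_graph_simple[OF G] by auto
    qed simp
    finally show ?thesis .
  qed
  then have "\<forall>\<^sub>F n in sequentially. \<forall>r\<in>pairs {..<n}.
     c \<le> measure_pmf.prob (random_graph n (real n powr (- 1 / l + \<epsilon>))) {G. r \<in> edges (perc_closure H G)}"
    by (intro eventually_sequentiallyI[of "2 * m"]) blast
  then show ?thesis using c by blast
qed

text \<open>
  \<open>1 - (1 - q) ^ k\<close> is the edge probability of the union of \<open>k\<close> independent copies of the
  random graph. Each copy fails to produce a given edge with probability at most \<open>1 - c\<close>, so all of
  them fail with probability at most \<open>exp (- c * k) \<le> 1 / n\<^sup>2\<close>, and there are at most \<open>n\<^sup>2 / 2\<close>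
  edges.
\<close>
lemma percolation_prob_ge_half:
  fixes H :: "'a graph"
  assumes q: "0 \<le> q" "q \<le> 1" and c: "0 < c" "c \<le> 1" and n: "n \<ge> 1"
    and edge: "\<And>r. r \<in> pairs {..<n} \<Longrightarrow>
       c \<le> measure_pmf.prob (random_graph n q) {G. r \<in> edges (perc_closure H G)}"
    and k: "2 * ln (real n) \<le> c * real k"
  shows "1 / 2 \<le> measure_pmf.prob (random_graph n (1 - (1 - q) ^ k))
     {G. perc_closure H G = complete_graph {..<n}}"
proof -
  let ?p = "1 - (1 - q) ^ k"
  let ?P = "measure_pmf.prob (random_graph n ?p)"
  let ?miss = "\<lambda>r. {G :: nat graph. r \<notin> edges (perc_closure H G)}"
  have miss: "?P (?miss r) \<le> 1 / (real n)\<^sup>2" if r: "r \<in> pairs {..<n}" for r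
  proof -
    have "?P (?miss r) \<le> measure_pmf.prob (random_graph n q) (?miss r) ^ k"
    proof (rule prob_decreasing_sprinkle[OF q])
      fix G G' :: "nat graph"
      assume "simple_graph G" "verts G = {..<n}" "verts G' = {..<n}" "edges G \<subseteq> edges G'"
        "r \<notin> edges (perc_closure H G')"
      then show "r \<notin> edges (perc_closure H G)"
        using perc_closure_mono[of G G' H] by auto
    qed
    also have "\<dots> \<le> (1 - c) ^ k"
    proof (rule power_mono)
      have "?miss r = - {G. r \<in> edges (perc_closure H G)}" by auto
      then show "measure_pmf.prob (random_graph n q) (?miss r) \<le> 1 - c"
        using edge[OF r] measure_pmf.prob_compl[of "{G. r \<in> edges (perc_closure H G)}" "random_graph n q"]
        by (simp add: Compl_eq_Diff_UNIV)
    qed simp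
    also have "\<dots> \<le> exp (- c) ^ k"
      using c exp_ge_add_one_self[of "- c"] by (intro power_mono) auto
    also have "\<dots> = exp (- (c * real k))" by (simp add: exp_of_nat_mult[symmetric] mult_ac)
    also have "\<dots> \<le> exp (- (2 * ln (real n)))" using k by simp
    also have "\<dots> = 1 / (real n)\<^sup>2"
      using n by (simp add: exp_minus field_simps exp_double)
    finally show ?thesis .
  qed
  have cp: "2 * card (pairs {..<n}) \<le> n\<^sup>2"
  proof -
    have "card (pairs {..<n}) = n choose 2" unfolding pairs_def using n_subsets[of "{..<n}" 2] by simp
    then have "2 * card (pairs {..<n}) \<le> n * (n - 1)" by (simp add: choose_two)
    also have "\<dots> \<le> n\<^sup>2" by (simp add: power2_eq_square)
    finally show ?thesis .
  qed
  have "1 - ?P {G. perc_closure H G = complete_graph {..<n}}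
      = ?P (- {G. perc_closure H G = complete_graph {..<n}})"
    by (simp add: measure_pmf.prob_compl[symmetric] Compl_eq_Diff_UNIV)
  also have "\<dots> \<le> ?P (\<Union>r\<in>pairs {..<n}. ?miss r)"
  proof (rule measure_pmf.finite_measure_mono_AE[OF AE_pmfI], rule impI)
    fix G assume G: "G \<in> set_pmf (random_graph n ?p)"
      and "G \<in> - {G. perc_closure H G = complete_graph {..<n}}"
    then have "edges (perc_closure H G) \<noteq> pairs {..<n}"
      using random_graph_simple[OF G] verts_perc_closure[of H G]
      by (auto simp: complete_graph_def prod_eq_iff)
    moreover have "edges (perc_closure H G) \<subseteq> pairs {..<n}"
      using perc_closure_subset_pairs random_graph_simple[OF G] by metis
    ultimately show "G \<in> (\<Union>r\<in>pairs {..<n}. ?miss r)" by auto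
  qed simp
  also have "\<dots> \<le> (\<Sum>r\<in>pairs {..<n}. ?P (?miss r))"
    by (rule measure_pmf.finite_measure_subadditive_finite) (auto simp: finite_pairs)
  also have "\<dots> \<le> (\<Sum>r\<in>pairs {..<n}. 1 / (real n)\<^sup>2)" using miss by (intro sum_mono)
  also have "\<dots> = real (card (pairs {..<n})) / (real n)\<^sup>2" by simp
  also have "\<dots> \<le> 1 / 2"
  proof -
    have "2 * real (card (pairs {..<n})) \<le> (real n)\<^sup>2" using cp by (metis of_nat_le_iff of_nat_mult of_nat_numeral of_nat_power)
    then show ?thesis using n by (simp add: divide_le_eq)
  qed
  finally show ?thesis by simp
qed

section \<open>No percolation below the threshold\<close>

lemma prob_dense_on_le:
  assumes p: "0 < p" "p \<le> 1" and U: "U \<subseteq> {..<n}"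
  shows "measure_pmf.prob (random_graph n p) {G. dense_on l G U}
     \<le> 2 ^ (2 ^ card U) * p powr (l * (real (card U) - 2) + 1)"
proof -
  let ?t = "l * (real (card U) - 2) + 1"
  define \<D> where "\<D> = {D. D \<subseteq> pairs U \<and> ?t \<le> real (card D)}"
  have finU: "finite U" using U finite_subset by blast
  have fin: "finite (pairs U)" using finU by (rule finite_pairs)
  have \<D>: "\<D> \<subseteq> Pow (pairs U)" by (auto simp: \<D>_def)
  then have fin\<D>: "finite \<D>" using fin finite_subset by blast
  have "card \<D> \<le> card (Pow (pairs U))" using \<D> fin by (intro card_mono) auto
  also have "\<dots> \<le> 2 ^ (2 ^ card U)" using fin card_pairs_le_power[OF finU] by (simp add: card_Pow)
  finally have c\<D>: "card \<D> \<le> 2 ^ (2 ^ card U)" .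
  have "measure_pmf.prob (random_graph n p) {G. dense_on l G U}
      \<le> measure_pmf.prob (random_graph n p) (\<Union>D\<in>\<D>. {G. D \<subseteq> edges G})"
    by (intro measure_pmf.finite_measure_mono) (auto simp: dense_on_def \<D>_def)
  also have "\<dots> \<le> (\<Sum>D\<in>\<D>. measure_pmf.prob (random_graph n p) {G. D \<subseteq> edges G})"
    by (rule measure_pmf.finite_measure_subadditive_finite) (use fin\<D> in auto)
  also have "\<dots> \<le> (\<Sum>D\<in>\<D>. p powr ?t)"
  proof (rule sum_mono)
    fix D assume D: "D \<in> \<D>"
    then have "D \<subseteq> pairs {..<n}" using pairs_mono[OF U] by (auto simp: \<D>_def)
    then have "measure_pmf.prob (random_graph n p) {G. D \<subseteq> edges G} = p powr real (card D)"
      using prob_random_graph_contains[of p D n] p by (simp add: powr_realpow)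
    also have "\<dots> \<le> p powr ?t" using p D by (intro powr_mono') (auto simp: \<D>_def)
    finally show "measure_pmf.prob (random_graph n p) {G. D \<subseteq> edges G} \<le> p powr ?t" .
  qed
  also have "\<dots> = real (card \<D>) * p powr ?t" by simp
  also have "\<dots> \<le> real (2 ^ (2 ^ card U)) * p powr ?t"
    using c\<D> by (intro mult_right_mono of_nat_mono) auto
  finally show ?thesis by simp
qed

lemma card_supersets_le:
  assumes r: "r \<subseteq> {..<n}" and m: "card r \<le> m"
  shows "card {U. r \<subseteq> U \<and> U \<subseteq> {..<n} \<and> card U = m} \<le> n ^ (m - card r)"
proof -
  have finr: "finite r" using r finite_subset by blast
  let ?A = "{U. r \<subseteq> U \<and> U \<subseteq> {..<n} \<and> card U = m}" and ?B = "{T. T \<subseteq> {..<n} \<and> card T = m - card r}"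
  have "card ?A \<le> card ?B"
  proof (rule card_inj_on_le[where f = "\<lambda>U. U - r"])
    show "inj_on (\<lambda>U. U - r) ?A" by (rule inj_onI) blast
    show "(\<lambda>U. U - r) ` ?A \<subseteq> ?B" using finr by (auto simp: card_Diff_subset)
  qed auto
  also have "\<dots> = n choose (m - card r)" using n_subsets[of "{..<n}"] by simp
  also have "\<dots> \<le> n ^ (m - card r)"
    by (cases "m - card r \<le> n") (auto intro: binomial_le_pow simp: binomial_eq_0)
  finally show ?thesis .
qed

text \<open>
  First moment bound: there are at most \<open>n ^ (m - card r)\<close> candidates for \<open>U\<close>, and each
  is dense with probability at most a constant times \<open>p powr (l * (m - 2) + 1)\<close>. In the lower bound for
  the threshold, \<open>r\<close> is a given edge or empty.
\<close>
lemma prob_exists_dense_superset_le: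
  assumes l: "l \<ge> 1" and \<delta>: "\<delta> \<ge> 0" and n: "n \<ge> 1" and p: "0 < p" "p \<le> real n powr (- 1 / l - \<delta>)"
    and r: "r \<subseteq> {..<n}" and m: "2 \<le> m" "card r \<le> 2" "card r \<le> m"
  shows "measure_pmf.prob (random_graph n p)
       {G. \<exists>U. r \<subseteq> U \<and> U \<subseteq> {..<n} \<and> card U = m \<and> dense_on l G U}
     \<le> 2 ^ (2 ^ m) * real n powr (2 - real (card r) - \<delta> * real (m - 2) - 1 / l)"
proof -
  let ?\<U> = "{U. r \<subseteq> U \<and> U \<subseteq> {..<n} \<and> card U = m}"
  let ?P = "measure_pmf.prob (random_graph n p)"
  have fin: "finite ?\<U>" by simp
  have "- 1 / l \<le> 0" using l by (simp add: divide_le_eq)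
  then have "- 1 / l - \<delta> \<le> 0" using \<delta> by linarith
  then have "real n powr (- 1 / l - \<delta>) \<le> real n powr 0" using n by (intro powr_mono) auto
  then have p1: "p \<le> 1" using p n by simp
  have "?P {G. \<exists>U. r \<subseteq> U \<and> U \<subseteq> {..<n} \<and> card U = m \<and> dense_on l G U}
      = ?P (\<Union>U\<in>?\<U>. {G. dense_on l G U})"
    by (rule arg_cong[where f = ?P]) auto
  also have "\<dots> \<le> (\<Sum>U\<in>?\<U>. ?P {G. dense_on l G U})"
    by (rule measure_pmf.finite_measure_subadditive_finite) (use fin in auto)
  also have "\<dots> \<le> (\<Sum>U\<in>?\<U>. 2 ^ (2 ^ m) * p powr (l * (real m - 2) + 1))"
    using prob_dense_on_le[OF p(1) p1] by (intro sum_mono) auto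
  also have "\<dots> = real (card ?\<U>) * (2 ^ (2 ^ m) * p powr (l * (real m - 2) + 1))" by simp
  also have "\<dots> \<le> real n powr (real m - real (card r)) *
      (2 ^ (2 ^ m) * real n powr ((- 1 / l - \<delta>) * (l * (real m - 2) + 1)))"
  proof (intro mult_mono mult_left_mono)
    have "real (card ?\<U>) \<le> real (n ^ (m - card r))"
      using card_supersets_le[OF r m(3)] of_nat_le_iff by blast
    also have "\<dots> = real n powr real (m - card r)" using n by (simp add: powr_realpow)
    finally show "real (card ?\<U>) \<le> real n powr (real m - real (card r))"
      using m by (simp add: of_nat_diff)
    have "p powr (l * (real m - 2) + 1) \<le> (real n powr (- 1 / l - \<delta>)) powr (l * (real m - 2) + 1)"
      using p l m by (intro powr_mono2) auto
    then show "p powr (l * (real m - 2) + 1) \<le> real n powr ((- 1 / l - \<delta>) * (l * (real m - 2) + 1))"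
      by (simp add: powr_powr)
  qed auto
  also have "\<dots> = 2 ^ (2 ^ m) * real n powr (real m - real (card r) + (- 1 / l - \<delta>) * (l * (real m - 2) + 1))"
    by (simp add: powr_add)
  also have "\<dots> \<le> 2 ^ (2 ^ m) * real n powr (2 - real (card r) - \<delta> * real (m - 2) - 1 / l)"
  proof (intro mult_left_mono powr_mono)
    have "real m - real (card r) + (- 1 / l - \<delta>) * (l * (real m - 2) + 1)
        = 2 - real (card r) - l * (\<delta> * real (m - 2)) - 1 / l - \<delta>"
      using l m by (simp add: of_nat_diff field_simps)
    moreover have "\<delta> * real (m - 2) \<le> l * (\<delta> * real (m - 2))"
      using l \<delta> mult_right_mono[of 1 l "\<delta> * real (m - 2)"] by simp
    ultimately show "real m - real (card r) + (- 1 / l - \<delta>) * (l * (real m - 2) + 1)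
        \<le> 2 - real (card r) - \<delta> * real (m - 2) - 1 / l" using \<delta> by linarith
  qed (use n in auto)
  finally show ?thesis .
qed

text \<open>
  For \<open>m < L\<close>, the factor \<open>n powr (- 1 / l)\<close> in the first moment bound for dense sets of size
  \<open>m\<close> containing \<open>{0, 1}\<close> suffices. For sizes from \<open>L\<close> to \<open>K\<close>, where no vertex is prescribed, there
  is an additional factor \<open>n\<^sup>2\<close>, and \<open>L\<close> is chosen such that \<open>\<delta> * (L - 2) \<ge> 3\<close> in order to
  absorb it.
\<close>
lemma percolation_prob_small:
  fixes H :: "'a graph"
  assumes H: "sub_sparse l H" and l: "l \<ge> 1" and \<delta>: "\<delta> > 0"
  shows "\<forall>\<^sub>F n in sequentially. \<forall>p. 0 < p \<longrightarrow> p \<le> real n powr (- 1 / l - \<delta>) \<longrightarrow>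
     measure_pmf.prob (random_graph n p) {G. perc_closure H G = complete_graph {..<n}} < 1 / 2"
proof -
  obtain L0 :: nat where L0: "3 / \<delta> \<le> real L0" using real_arch_simple by blast
  define L where "L = L0 + 3"
  have L3: "3 \<le> L" by (simp add: L_def)
  have "3 \<le> \<delta> * real L0" using L0 \<delta> by (simp add: divide_le_eq mult.commute)
  also have "\<dots> \<le> \<delta> * real (L - 2)" using \<delta> by (intro mult_left_mono) (auto simp: L_def)
  finally have \<delta>L: "3 \<le> \<delta> * real (L - 2)" .
  define K where "K = card (edges H) * L + 2"
  define C where "C = real L * 2 ^ 2 ^ L + (real K + 1) * 2 ^ 2 ^ K"
  have C0: "0 < C" unfolding C_def using L3 by (simp add: add_pos_nonneg)
  have bound: "measure_pmf.prob (random_graph n p) {G. perc_closure H G = complete_graph {..<n}}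
      \<le> C * real n powr (- 1 / l)"
    if n: "2 \<le> n" and p: "0 < p" "p \<le> real n powr (- 1 / l - \<delta>)" for n p
  proof -
    let ?P = "measure_pmf.prob (random_graph n p)"
    let ?E = "\<lambda>r m. {G. \<exists>U. r \<subseteq> U \<and> U \<subseteq> {..<n} \<and> card U = m \<and> dense_on l G U}"
    have n1: "1 \<le> n" using n by simp
    have r: "{0, 1} \<subseteq> {..<n}" using n by auto
    note b = prob_exists_dense_superset_le[OF l less_imp_le[OF \<delta>] n1 p]
    have small: "?P (?E {0, 1} m) \<le> 2 ^ 2 ^ L * real n powr (- 1 / l)" if m: "m \<in> {2..<L}" for m
    proof -
      have "?P (?E {0, 1} m) \<le> 2 ^ 2 ^ m * real n powr (2 - real (card {0, 1::nat}) - \<delta> * real (m - 2) - 1 / l)"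
        using m by (intro b[OF r]) auto
      also have "\<dots> \<le> 2 ^ 2 ^ L * real n powr (- 1 / l)"
        using m n \<delta> by (intro mult_mono powr_mono power_increasing) auto
      finally show ?thesis .
    qed
    have large: "?P (?E {} m) \<le> 2 ^ 2 ^ K * real n powr (- 1 / l)" if m: "m \<in> {L..K}" for m
    proof -
      have "?P (?E {} m) \<le> 2 ^ 2 ^ m * real n powr (2 - real (card ({} :: nat set)) - \<delta> * real (m - 2) - 1 / l)"
        using m L3 by (intro b) auto
      also have "\<dots> \<le> 2 ^ 2 ^ K * real n powr (- 1 / l)"
      proof (intro mult_mono powr_mono power_increasing)
        have "\<delta> * real (L - 2) \<le> \<delta> * real (m - 2)" using m \<delta> by (intro mult_left_mono) auto
        then show "2 - real (card ({} :: nat set)) - \<delta> * real (m - 2) - 1 / l \<le> - 1 / l"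
          using \<delta>L unfolding card.empty of_nat_0 by linarith
      qed (use m n in auto)
      finally show ?thesis .
    qed
    have "?P {G. perc_closure H G = complete_graph {..<n}}
        \<le> ?P ((\<Union>m\<in>{2..<L}. ?E {0, 1} m) \<union> (\<Union>m\<in>{L..K}. ?E {} m))"
    proof (rule measure_pmf.finite_measure_mono_AE[OF AE_pmfI], rule impI, rule ccontr)
      fix G assume G: "G \<in> set_pmf (random_graph n p)"
        and perc: "G \<in> {G. perc_closure H G = complete_graph {..<n}}"
        and none: "G \<notin> (\<Union>m\<in>{2..<L}. ?E {0, 1} m) \<union> (\<Union>m\<in>{L..K}. ?E {} m)"
      note G' = random_graph_simple[OF G]
      have "{0, 1} \<in> edges (perc_closure H G)"
        using perc n by (simp add: complete_graph_def doubleton_in_pairs)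
      moreover have "\<not> dense_on l G U"
        if "U \<subseteq> verts G" "L \<le> card U" "card U \<le> card (edges H) * L + 2" for U
      proof
        assume "dense_on l G U"
        then have "G \<in> ?E {} (card U)" using that G'(2) by auto
        moreover have "card U \<in> {L..K}" using that by (simp add: K_def)
        ultimately show False using none by blast
      qed
      ultimately obtain U where U: "{0, 1} \<subseteq> U" "U \<subseteq> {..<n}" "card U < L" "dense_on l G U"
        using closure_edge_in_small_dense_set[OF H order_trans[OF zero_le_one l] G'(1) L3] G'(2) by metis
      have "card {0, 1::nat} \<le> card U" using U finite_subset by (intro card_mono) auto
      then have "card U \<in> {2..<L}" using U by simp
      moreover have "G \<in> ?E {0, 1} (card U)" using U by auto
      ultimately show False using none by blast
    qed simp
    also have "\<dots> \<le> ?P (\<Union>m\<in>{2..<L}. ?E {0, 1} m) + ?P (\<Union>m\<in>{L..K}. ?E {} m)"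
      by (rule measure_Un_le) auto
    also have "\<dots> \<le> (\<Sum>m\<in>{2..<L}. ?P (?E {0, 1} m)) + (\<Sum>m\<in>{L..K}. ?P (?E {} m))"
      by (intro add_mono measure_pmf.finite_measure_subadditive_finite) auto
    also have "\<dots> \<le> (\<Sum>m\<in>{2..<L}. 2 ^ 2 ^ L * real n powr (- 1 / l)) + (\<Sum>m\<in>{L..K}. 2 ^ 2 ^ K * real n powr (- 1 / l))"
      using small large by (intro add_mono sum_mono)
    also have "\<dots> = (real (L - 2) * 2 ^ 2 ^ L + real (Suc K - L) * 2 ^ 2 ^ K) * real n powr (- 1 / l)"
      by (simp add: algebra_simps)
    also have "\<dots> \<le> C * real n powr (- 1 / l)"
      unfolding C_def by (intro mult_right_mono add_mono) auto
    finally show ?thesis .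
  qed
  have "((\<lambda>n. C * real n powr (- 1 / l)) \<longlongrightarrow> C * 0) sequentially"
    using l by (intro tendsto_mult_left tendsto_neg_powr filterlim_real_sequentially) simp
  then have "\<forall>\<^sub>F n in sequentially. C * real n powr (- 1 / l) < 1 / 2"
    by (rule order_tendstoD(2)) simp
  then show ?thesis using eventually_ge_at_top[of 2]
  proof eventually_elim
    case (elim n)
    then show ?case using bound[of n] by (meson le_less_trans)
  qed
qed

section \<open>The critical probability\<close>

definition perc_probs :: "nat \<Rightarrow> 'a graph \<Rightarrow> real set" where
  "perc_probs n H = {p. 0 < p \<and> p \<le> 1 \<and>
     measure_pmf.prob (random_graph n p) {G. perc_closure H G = complete_graph {..<n}} \<ge> 1 / 2}"

lemma perc_prob_upper:
  fixes H :: "'a graph"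
  assumes H: "sub_sparse l H" and l: "l \<ge> 1" and v: "card (verts H) \<ge> 3"
    and \<epsilon>: "0 < \<epsilon>"
  shows "\<forall>\<^sub>F n in sequentially. \<exists>p\<in>perc_probs n H. p \<le> real n powr (- 1 / l + \<epsilon>)"
proof -
  \<comment> \<open>half of \<open>\<epsilon>\<close> is kept for the factor \<open>k\<close> of order \<open>log n\<close>; \<open>a \<le> 1 / l\<close> makes \<open>q\<close> a probability\<close>
  define a where "a = min (\<epsilon> / 2) (1 / l)"
  have a: "0 < a" "a \<le> 1 / l" "a \<le> \<epsilon> / 2" using l \<epsilon> by (auto simp: a_def)
  obtain c where c: "0 < c" "c \<le> 1" and edge: "\<forall>\<^sub>F n in sequentially. \<forall>r\<in>pairs {..<n}.
     c \<le> measure_pmf.prob (random_graph n (real n powr (- 1 / l + a)))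
          {G. r \<in> edges (perc_closure H G)}"
    using prob_edge_in_closure_ge[OF H l v a(1,2)] by blast
  have log: "\<forall>\<^sub>F n in sequentially. 2 * ln (real n) / c + 1 \<le> real n powr (\<epsilon> / 2)"
    using c \<epsilon> by real_asymp
  show ?thesis using edge log eventually_ge_at_top[of 2]
  proof eventually_elim
    case (elim n)
    define q where "q = real n powr (- 1 / l + a)"
    define k where "k = nat \<lceil>2 * ln (real n) / c\<rceil>"
    have ln0: "0 < 2 * ln (real n) / c" using elim c by simp
    then have k0: "0 < k" by (simp add: k_def)
    have kge: "2 * ln (real n) / c \<le> real k" unfolding k_def by linarith
    have kle: "real k \<le> 2 * ln (real n) / c + 1" unfolding k_def using ln0 by linarith
    have "q \<le> real n powr 0" unfolding q_def using elim a by (intro powr_mono) auto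
    then have q: "0 < q" "q \<le> 1" using elim by (auto simp: q_def)
    define p where "p = 1 - (1 - q) ^ k"
    have "(1 - q) ^ k < 1 ^ k" using q k0 by (intro power_strict_mono) auto
    then have p0: "0 < p" by (simp add: p_def)
    have p1: "p \<le> 1" using q by (simp add: p_def)
    have "2 * ln (real n) \<le> c * real k" using kge c by (simp add: divide_le_eq mult.commute)
    then have "1 / 2 \<le> measure_pmf.prob (random_graph n p) {G. perc_closure H G = complete_graph {..<n}}"
      unfolding p_def using elim q c
      by (intro percolation_prob_ge_half[where c = c]) (auto simp: q_def)
    then have "p \<in> perc_probs n H" using p0 p1 by (simp add: perc_probs_def)
    moreover have "p \<le> real n powr (- 1 / l + \<epsilon>)"
    proof -
      have "p \<le> real k * q" using Bernoulli_inequality[of "- q" k] q by (simp add: p_def)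
      also have "\<dots> \<le> real n powr (\<epsilon> / 2) * real n powr (- 1 / l + \<epsilon> / 2)"
      proof (rule mult_mono)
        show "real k \<le> real n powr (\<epsilon> / 2)" using kle elim by linarith
        show "q \<le> real n powr (- 1 / l + \<epsilon> / 2)" unfolding q_def using a elim by (intro powr_mono) auto
      qed (use q in auto)
      also have "\<dots> = real n powr (- 1 / l + \<epsilon>)" by (simp add: powr_add[symmetric])
      finally show ?thesis .
    qed
    ultimately show ?case by blast
  qed
qed

lemma p_crit_bounds:
  fixes H :: "'a graph"
  assumes H: "sub_sparse l H" and l: "l \<ge> 1" and v: "card (verts H) \<ge> 3"
    and \<epsilon>: "0 < \<epsilon>"
  shows "\<forall>\<^sub>F n in sequentially. real n powr (- 1 / l - \<epsilon>) \<le> p_crit n H \<and>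
     p_crit n H \<le> real n powr (- 1 / l + \<epsilon>)"
  using perc_prob_upper[OF assms] percolation_prob_small[OF H l \<epsilon>]
proof eventually_elim
  case (elim n)
  have pc: "p_crit n H = Inf (perc_probs n H)" by (simp add: p_crit_def perc_probs_def)
  obtain p where p: "p \<in> perc_probs n H" "p \<le> real n powr (- 1 / l + \<epsilon>)" using elim(1) by blast
  have low: "real n powr (- 1 / l - \<epsilon>) \<le> x" if "x \<in> perc_probs n H" for x
    using elim(2) that unfolding perc_probs_def by force
  have "real n powr (- 1 / l - \<epsilon>) \<le> p_crit n H"
    unfolding pc using p low by (intro cInf_greatest) auto
  moreover have "p_crit n H \<le> p"
    unfolding pc using p low by (intro cInf_lower bdd_belowI[of _ "real n powr (- 1 / l - \<epsilon>)"]) auto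
  ultimately show ?case using p by linarith
qed

theorem theorem2:
  fixes H :: "'a graph"
  assumes "simple_graph H"
    and "card (verts H) \<ge> 4"
    and "balanced H"
    and "min_degree H \<ge> 2"
  shows "\<exists>\<epsilon> :: nat \<Rightarrow> real. \<epsilon> \<longlonglongrightarrow> 0 \<and>
    (\<forall>\<^sub>F n in sequentially. p_crit n H = real n powr (- 1 / lam H + \<epsilon> n))"
proof -
  have H: "sub_sparse (lam H) H" using assms by (intro balanced_imp_sub_sparse)
  have l: "lam H \<ge> 1" using assms by (intro lam_ge_1)
  have v: "card (verts H) \<ge> 3" using assms(2) by simp
  note bounds = p_crit_bounds[OF H l v]
  define \<epsilon> where "\<epsilon> = (\<lambda>n. ln (p_crit n H) / ln (real n) + 1 / lam H)"
  have rep: "p_crit n H = real n powr (- 1 / lam H + \<epsilon> n)"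
    if "2 \<le> n" "real n powr (- 1 / lam H - 1) \<le> p_crit n H" for n
  proof -
    have "0 < real n powr (- 1 / lam H - 1)" using that by simp
    then have "0 < p_crit n H" using that by linarith
    then show ?thesis using that by (simp add: \<epsilon>_def powr_def)
  qed
  have "\<forall>\<^sub>F n in sequentially. p_crit n H = real n powr (- 1 / lam H + \<epsilon> n)"
    using bounds[of 1, simplified] eventually_ge_at_top[of 2]
    by eventually_elim (use rep in simp)
  moreover have "\<epsilon> \<longlonglongrightarrow> 0"
  proof (rule tendstoI)
    fix e :: real assume e: "0 < e"
    have e2: "0 < e / 2" using e by simp
    show "\<forall>\<^sub>F n in sequentially. dist (\<epsilon> n) 0 < e"
      using bounds[OF e2] bounds[OF zero_less_one] eventually_ge_at_top[of 2]
    proof eventually_elim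
      case (elim n)
      have n: "1 < real n" using elim by simp
      have "real n powr (- 1 / lam H - e / 2) \<le> real n powr (- 1 / lam H + \<epsilon> n)"
        "real n powr (- 1 / lam H + \<epsilon> n) \<le> real n powr (- 1 / lam H + e / 2)"
        using elim rep[of n] by auto
      then have "- (e / 2) \<le> \<epsilon> n" "\<epsilon> n \<le> e / 2" using n by auto
      then show ?case using e by (simp add: dist_real_def abs_le_iff)
    qed
  qed
  ultimately show ?thesis by blast
qed

end
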